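(* There exists $C>0$ (independent of $u$, $\sigma$ and $c_\sigma$) such that the following holds. If $u \in L^{\infty}(\mathbb{B}_n)$ and $\sigma \in u B_1 \cap B_{\infty}$ satisfies $\sigma(z)\le c_\sigma\,\sigma(w)$ for all $K\in\mathcal{D}$ and all $z,w\in K$, where $c_\sigma>0$ is a constant, then $T_u$ acts boundedly from $L^1_{\sigma}$ to $L^{1,\infty}_{\sigma}$ with $$\|T_u\|_{L^1_{\sigma}\rightarrow L^{1,\infty}_{\sigma}}\leq C\,[\sigma]_{uB_1}\, c_{\sigma}^{\frac{1}{2\alpha [\sigma]_{B_\infty}+1}}\log(e+[\sigma]_{B_{\infty}}).$$
   Context: $\mathbb{B}_n$ is the open unit ball of $\mathbb{C}^n$, $V$ is normalized Lebesgue measure on $\mathbb{B}_n$, $|A|=V(A)$, $z\overline{w}=\sum_{j=1}^n z_j\overline{w}_j$. For $u\in L^\infty$ the Toeplitz operator is $T_uf(z)=\int_{\mathbb{B}_n}\frac{u(w)f(w)}{(1-z\overline{w})^{n+1}}\,dV(w)$. A weight is a locally integrable function on $\mathbb{B}_n$ that is positive almost everywhere; $\sigma(A)=\int_A\sigma\,dV$; $\langle f\rangle_A=\frac{1}{|A|}\int_A f\,dV$; $\|f\|_{L^1_\sigma}=\int_{\mathbb{B}_n}|f|\sigma\,dV$; $\|f\|_{L^{1,\infty}_\sigma}=\sup_{\lambda>0}\lambda\,\sigma(\{z:|f(z)|>\lambda\})$. $\|T\|_{L^1_\sigma\to L^{1,\infty}_\sigma}$ is the smallest constant $A$ with $\|Tf\|_{L^{1,\infty}_\sigma}\le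 A\|f\|_{L^1_\sigma}$ for all $f$. Dyadic structure. The Carleson tent over $z\in\mathbb{B}_n\setminus\{0\}$ is $\mathcal{T}_z=\{w\in\mathbb{B}_n: |1-\overline{w}\frac{z}{|z|}|<1-|z|\}$, and $\mathcal{T}_0=\mathbb{B}_n$. Let $\phi_z$ be the involutive automorphism of $\mathbb{B}_n$ interchanging $z$ and $0$, $\beta(z,w)=\frac12\log\frac{1+|\phi_z(w)|}{1-|\phi_z(w)|}$ the Bergman metric, and $B_\beta(z,s)$ its balls. Fix $\theta_0,\lambda_0>0$. For $k\geq1$ let $\mathbb{S}_{k\theta_0}=\{z:\beta(0,z)=k\theta_0\}$, and choose points $w_j^k$ and Borel sets $Q_j^k\subseteq\mathbb{S}_{k\theta_0}$ containing $w_j^k$ ($1\le j\le J_k$), pairwise disjoint for fixed $k$, with union $\mathbb{S}_{k\theta_0}$, and such that $\mathbb{S}_{k\theta_0}\cap B_\beta(w_j^k,\lambda_0)\subseteq Q_j^k\subseteq\mathbb{S}_{k\theta_0}\cap B_\beta(w_j^k,C_0\lambda_0)$ for a constant $C_0>1$. Let $P_{s}z$ be the radial projection of $z$ onto $\{\beta(0,\cdot)=s\}$. The kubes are $K_1^0=B_\beta(0,\theta_0)$ and $K_j^k=\{z: k\theta_0<\beta(0,z)\le(k+1)\theta_0,\ P_{k\theta_0}z\in Q_j^k\}$, $k\geq1$; the center of $K_j^k$ is $c_j^k=P_{(k+\frac12)\theta_0}w_j^k$ and its generation is $k$. For $k_1>k_2\ge1$, $K_{j_1}^{k_1}$ is a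 descendant of $K_{j_2}^{k_2}$ if $P_{k_2\theta_0}c_{j_1}^{k_1}\in Q_{j_2}^{k_2}$ (a child if $k_1=k_2+1$); all kubes of generation $\ge 1$ are descendants of $K_1^0$, those of generation 1 being its children. The dyadic tent $\widehat{K}$ is the union of $K$ and all its descendants. A dyadic structure is the collection of kubes so obtained. One fixes a finite collection $\mathcal{D}_1,\dots,\mathcal{D}_M$ of such structures so that, in each $\mathcal{D}_\ell$, two tents are either disjoint or nested and $|K|\approx|\widehat{K}|\approx(1-|c_K|^2)^{n+1}$ uniformly, and so that every Carleson tent is contained in some tent $\widehat{K}$ of comparable measure, and every $\widehat{K}$ is contained in some Carleson tent of comparable measure. Put $\mathcal{D}=\bigcup_{\ell=1}^M\mathcal{D}_\ell$. The constant $\alpha>1$ is a fixed dyadic doubling constant: $|\widehat{K}|\le\alpha|\widehat{K'}|$ whenever $K'$ is a child of $K$ in one of the $\mathcal{D}_\ell$. A weight $\sigma$ is in $uB_1$ if $[\sigma]_{uB_1}=\sup_{K\in\mathcal{D}}\|u\|_{L^\infty(\widehat{K})}\langle\sigma\rangle_{\widehat{K}}\|\sigma^{-1}\|_{L^\infty(\widehat{K})}<\infty$. With $Mf(z)=\sup_{K\in\mathcal{D}}\langle|f|\rangle_{\widehat{K}}\chi_{\widehat{K}}(z)$, $\sigma$ is in $B_\infty$ if $[\sigma]_{B_\infty}=\sup_{K\in\mathcal{D}}\frac{1}{\sigma(\widehat{K})}\int_{\widehat{K}}M(\sigma\chi_{\widehat{K}})\,dV<\infty$. *)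

theory Defs
  imports "HOL-Analysis.Analysis" "HOL-Probability.Essential_Supremum"
begin

text \<open>
  The dimension \<open>n\<close> is \<open>CARD('n)\<close>, and the unit ball of \<open>\<complex>\<^sup>n\<close> is
  \<open>ball 0 1 :: (complex^'n) set\<close>.
\<close>

subsection \<open>Measure, pairing and Toeplitz operators\<close>

definition ball_vol :: "(complex^'n::finite) measure" where
  "ball_vol = uniform_measure (lebesgue_on (ball 0 1)) (ball 0 1)"

definition herm :: "complex^'n \<Rightarrow> complex^'n::finite \<Rightarrow> complex" where
  "herm z w = (\<Sum>j\<in>UNIV. z $ j * cnj (w $ j))"

definition toeplitz_integrand ::
  "(complex^'n \<Rightarrow> complex) \<Rightarrow> (complex^'n \<Rightarrow> complex) \<Rightarrow> complex^'n \<Rightarrow> complex^'n::finite \<Rightarrow> complex" where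
  "toeplitz_integrand u f z w = u w * f w / (1 - herm z w) ^ (CARD('n) + 1)"

definition toeplitz ::
  "(complex^'n \<Rightarrow> complex) \<Rightarrow> (complex^'n \<Rightarrow> complex) \<Rightarrow> complex^'n::finite \<Rightarrow> complex" where
  "toeplitz u f z = integral\<^sup>L ball_vol (toeplitz_integrand u f z)"

definition Linfty_norm :: "(complex^'n::finite) set \<Rightarrow> (complex^'n \<Rightarrow> 'a::real_normed_vector) \<Rightarrow> ennreal" where
  "Linfty_norm A g = esssup (restrict_space ball_vol A) (\<lambda>z. ennreal (norm (g z)))"

definition Linfty :: "(complex^'n::finite \<Rightarrow> complex) set" where
  "Linfty = {u \<in> borel_measurable ball_vol. Linfty_norm (ball 0 1) u < \<infinity>}"


subsection \<open>Weights and weighted spaces\<close>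

definition weight :: "(complex^'n::finite \<Rightarrow> real) \<Rightarrow> bool" where
  "weight \<sigma> \<longleftrightarrow> \<sigma> \<in> borel_measurable ball_vol
     \<and> (\<forall>S. compact S \<and> S \<subseteq> ball 0 1 \<longrightarrow> set_integrable ball_vol S \<sigma>)
     \<and> (AE z in ball_vol. 0 < \<sigma> z)"

definition weight_meas :: "(complex^'n::finite \<Rightarrow> real) \<Rightarrow> (complex^'n) set \<Rightarrow> ennreal" where
  "weight_meas \<sigma> A = (\<integral>\<^sup>+z\<in>A. ennreal (\<sigma> z) \<partial>ball_vol)"

text \<open>Averages are only needed for nonnegative functions, so they are taken with values in
  \<^typ>\<open>ennreal\<close>.\<close>

definition average :: "(complex^'n::finite) set \<Rightarrow> (complex^'n \<Rightarrow> ennreal) \<Rightarrow> ennreal" where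
  "average A g = (\<integral>\<^sup>+z\<in>A. g z \<partial>ball_vol) / emeasure ball_vol A"

definition L1_norm :: "(complex^'n::finite \<Rightarrow> real) \<Rightarrow> (complex^'n \<Rightarrow> complex) \<Rightarrow> ennreal" where
  "L1_norm \<sigma> f = (\<integral>\<^sup>+z. ennreal (norm (f z)) * ennreal (\<sigma> z) \<partial>ball_vol)"

definition L1_space :: "(complex^'n::finite \<Rightarrow> real) \<Rightarrow> (complex^'n \<Rightarrow> complex) set" where
  "L1_space \<sigma> = {f \<in> borel_measurable ball_vol. L1_norm \<sigma> f < \<infinity>}"

definition weak_L1_norm :: "(complex^'n::finite \<Rightarrow> real) \<Rightarrow> (complex^'n \<Rightarrow> complex) \<Rightarrow> ennreal" where
  "weak_L1_norm \<sigma> f =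
     (SUP t\<in>{0<..}. ennreal t * weight_meas \<sigma> {z \<in> ball 0 1. t < norm (f z)})"

definition weak_L1_space :: "(complex^'n::finite \<Rightarrow> real) \<Rightarrow> (complex^'n \<Rightarrow> complex) set" where
  "weak_L1_space \<sigma> = {f \<in> borel_measurable ball_vol. weak_L1_norm \<sigma> f < \<infinity>}"

definition weak_op_norm ::
  "(complex^'n::finite \<Rightarrow> real) \<Rightarrow> ((complex^'n \<Rightarrow> complex) \<Rightarrow> complex^'n \<Rightarrow> complex) \<Rightarrow> ennreal" where
  "weak_op_norm \<sigma> T = Inf {A. \<forall>f\<in>L1_space \<sigma>. weak_L1_norm \<sigma> (T f) \<le> A * L1_norm \<sigma> f}"


subsection \<open>Bergman metric and Carleson tents\<close>

definition carleson_tent :: "complex^'n \<Rightarrow> (complex^'n::finite) set" where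
  "carleson_tent z = (if z = 0 then ball 0 1
     else {w \<in> ball 0 1. norm (1 - herm (z /\<^sub>R norm z) w) < 1 - norm z})"

text \<open>Rudin's formula for the involution \<open>\<phi>\<^sub>a\<close>: \<open>p\<close> is the orthogonal projection of \<open>w\<close> onto the
  complex line through \<open>a\<close> (which is \<open>0\<close> for \<open>a = 0\<close>, because division by zero gives zero).\<close>

definition ball_involution :: "complex^'n \<Rightarrow> complex^'n \<Rightarrow> complex^'n::finite" where
  "ball_involution a w =
     (let p = (herm w a / herm a a) *s a
      in inverse (1 - herm w a) *s (a - p - sqrt (1 - (norm a)\<^sup>2) *\<^sub>R (w - p)))"

definition bergman_dist :: "complex^'n \<Rightarrow> complex^'n::finite \<Rightarrow> real" where
  "bergman_dist z w =
     ln ((1 + norm (ball_involution z w)) / (1 - norm (ball_involution z w))) / 2"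

definition bergman_ball :: "complex^'n \<Rightarrow> real \<Rightarrow> (complex^'n::finite) set" where
  "bergman_ball z s = {w \<in> ball 0 1. bergman_dist z w < s}"

definition bergman_sphere :: "real \<Rightarrow> (complex^'n::finite) set" where
  "bergman_sphere s = {w \<in> ball 0 1. bergman_dist 0 w = s}"

text \<open>The Bergman sphere of radius \<open>s\<close> about \<open>0\<close> is the Euclidean one of radius \<open>tanh s\<close>.\<close>

definition radial_proj :: "real \<Rightarrow> complex^'n \<Rightarrow> complex^'n::finite" where
  "radial_proj s z = (tanh s / norm z) *\<^sub>R z"

lemma ball_involution_0_right: "ball_involution a 0 = a"
  by (simp add: ball_involution_def herm_def vec_eq_iff)

lemma ball_involution_self:
  fixes a :: "complex^'n::finite"
  assumes "norm a < 1"
  shows "ball_involution a a = 0"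
proof (cases "a = 0")
  case False
  have "herm a a = of_real ((norm a)\<^sup>2)"
    by (simp add: herm_def norm_vec_def L2_set_def sum_nonneg complex_norm_square[symmetric])
  with False show ?thesis by (simp add: ball_involution_def)
qed (simp add: ball_involution_def)

lemma norm_ball_involution_0_left: "norm (ball_involution 0 w) = norm w"
  by (simp add: ball_involution_def herm_def Let_def)

lemma bergman_dist_radial_proj:
  assumes "z \<noteq> 0" "s \<ge> 0"
  shows "radial_proj s z \<in> ball 0 1" "bergman_dist 0 (radial_proj s z) = s"
proof -
  have *: "norm (radial_proj s z) = tanh s"
    using assms by (simp add: radial_proj_def)
  show "radial_proj s z \<in> ball 0 1"
    using * tanh_real_lt_1[of s] by simp
  show "bergman_dist 0 (radial_proj s z) = s"
    using artanh_tanh_real[of s]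
    by (simp add: bergman_dist_def norm_ball_involution_0_left * artanh_def)
qed


subsection \<open>Dyadic structures\<close>

text \<open>Generation \<open>k \<ge> 1\<close> of a structure \<open>S\<close> has the points \<open>node S k j\<close> and the cells
  \<open>cell S k j\<close> for \<open>1 \<le> j \<le> num S k\<close>; the values at other indices are irrelevant.
  A kube of \<open>S\<close> is addressed by its index \<open>(k, j)\<close>.\<close>

record 'n dyadic_structure =
  num :: "nat \<Rightarrow> nat"
  node :: "nat \<Rightarrow> nat \<Rightarrow> complex^'n"
  cell :: "nat \<Rightarrow> nat \<Rightarrow> (complex^'n) set"

definition is_dyadic_structure ::
  "real \<Rightarrow> real \<Rightarrow> real \<Rightarrow> ('n::finite) dyadic_structure \<Rightarrow> bool" where
  "is_dyadic_structure \<theta> \<rho> C\<^sub>0 S \<longleftrightarrow> (\<forall>k\<ge>1.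
     (\<forall>j\<in>{1..num S k}.
        cell S k j \<in> sets borel \<and> node S k j \<in> cell S k j \<and>
        bergman_sphere (k * \<theta>) \<inter> bergman_ball (node S k j) \<rho> \<subseteq> cell S k j \<and>
        cell S k j \<subseteq> bergman_sphere (k * \<theta>) \<inter> bergman_ball (node S k j) (C\<^sub>0 * \<rho>)) \<and>
     disjoint_family_on (cell S k) {1..num S k} \<and>
     (\<Union>j\<in>{1..num S k}. cell S k j) = bergman_sphere (k * \<theta>))"

definition kube_ids :: "('n::finite) dyadic_structure \<Rightarrow> (nat \<times> nat) set" where
  "kube_ids S = insert (0, 1) {(k, j). 1 \<le> k \<and> 1 \<le> j \<and> j \<le> num S k}"

text \<open>The root kube is the closed Bergman ball: with the open one, the sphere
  \<open>bergman_sphere \<theta>\<close> would lie in no kube, and then no dyadic tent could contain the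
  Carleson tent over \<open>0\<close>, which is the whole unit ball.\<close>

definition kube :: "real \<Rightarrow> ('n::finite) dyadic_structure \<Rightarrow> nat \<times> nat \<Rightarrow> (complex^'n) set" where
  "kube \<theta> S = (\<lambda>(k, j).
     if k = 0 then {z \<in> ball 0 1. bergman_dist 0 z \<le> \<theta>}
     else {z \<in> ball 0 1. k * \<theta> < bergman_dist 0 z \<and> bergman_dist 0 z \<le> (k + 1) * \<theta>
             \<and> radial_proj (k * \<theta>) z \<in> cell S k j})"

definition kube_center :: "real \<Rightarrow> ('n::finite) dyadic_structure \<Rightarrow> nat \<times> nat \<Rightarrow> complex^'n" where
  "kube_center \<theta> S = (\<lambda>(k, j).
     if k = 0 then 0 else radial_proj ((k + 1/2) * \<theta>) (node S k j))"

definition kube_descendant ::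
  "real \<Rightarrow> ('n::finite) dyadic_structure \<Rightarrow> nat \<times> nat \<Rightarrow> nat \<times> nat \<Rightarrow> bool" where
  "kube_descendant \<theta> S K\<^sub>1 K\<^sub>2 \<longleftrightarrow>
     K\<^sub>1 \<in> kube_ids S \<and> K\<^sub>2 \<in> kube_ids S \<and> fst K\<^sub>2 < fst K\<^sub>1 \<and>
     (fst K\<^sub>2 = 0 \<or> radial_proj (real (fst K\<^sub>2) * \<theta>) (kube_center \<theta> S K\<^sub>1) \<in> cell S (fst K\<^sub>2) (snd K\<^sub>2))"

definition kube_child ::
  "real \<Rightarrow> ('n::finite) dyadic_structure \<Rightarrow> nat \<times> nat \<Rightarrow> nat \<times> nat \<Rightarrow> bool" where
  "kube_child \<theta> S K\<^sub>1 K\<^sub>2 \<longleftrightarrow> kube_descendant \<theta> S K\<^sub>1 K\<^sub>2 \<and> fst K\<^sub>1 = fst K\<^sub>2 + 1"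

definition tent :: "real \<Rightarrow> ('n::finite) dyadic_structure \<Rightarrow> nat \<times> nat \<Rightarrow> (complex^'n) set" where
  "tent \<theta> S K = kube \<theta> S K \<union> (\<Union>K'\<in>{K'. kube_descendant \<theta> S K' K}. kube \<theta> S K')"

text \<open>The kubes of all structures of a collection \<open>\<SS>\<close>, as pairs of a structure and an index.\<close>

definition all_kubes ::
  "('n::finite) dyadic_structure set \<Rightarrow> ('n dyadic_structure \<times> nat \<times> nat) set" where
  "all_kubes \<SS> = Sigma \<SS> kube_ids"

definition dyadic_system ::
  "real \<Rightarrow> real \<Rightarrow> real \<Rightarrow> ('n::finite) dyadic_structure set \<Rightarrow> bool" where
  "dyadic_system \<theta> \<rho> C\<^sub>0 \<SS> \<longleftrightarrow>
     0 < \<theta> \<and> 0 < \<rho> \<and> 1 < C\<^sub>0 \<and> finite \<SS> \<and>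
     (\<forall>S\<in>\<SS>. is_dyadic_structure \<theta> \<rho> C\<^sub>0 S) \<and>
     (\<forall>S\<in>\<SS>. \<forall>K\<in>kube_ids S. \<forall>K'\<in>kube_ids S.
        tent \<theta> S K \<inter> tent \<theta> S K' = {} \<or> tent \<theta> S K \<subseteq> tent \<theta> S K' \<or> tent \<theta> S K' \<subseteq> tent \<theta> S K) \<and>
     (\<exists>A::real.
        (\<forall>(S, K)\<in>all_kubes \<SS>.
           (let m = (1 - (norm (kube_center \<theta> S K))\<^sup>2) ^ (CARD('n) + 1)
            in measure ball_vol (kube \<theta> S K) \<le> A * measure ball_vol (tent \<theta> S K) \<and>
               measure ball_vol (tent \<theta> S K) \<le> A * measure ball_vol (kube \<theta> S K) \<and>
               measure ball_vol (tent \<theta> S K) \<le> A * m \<and>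
               m \<le> A * measure ball_vol (tent \<theta> S K))) \<and>
        (\<forall>z\<in>ball 0 1. \<exists>(S, K)\<in>all_kubes \<SS>. carleson_tent z \<subseteq> tent \<theta> S K \<and>
           measure ball_vol (tent \<theta> S K) \<le> A * measure ball_vol (carleson_tent z)) \<and>
        (\<forall>(S, K)\<in>all_kubes \<SS>. \<exists>z\<in>ball 0 1. tent \<theta> S K \<subseteq> carleson_tent z \<and>
           measure ball_vol (carleson_tent z) \<le> A * measure ball_vol (tent \<theta> S K)))"

definition dyadic_doubling ::
  "real \<Rightarrow> ('n::finite) dyadic_structure set \<Rightarrow> real \<Rightarrow> bool" where
  "dyadic_doubling \<theta> \<SS> \<alpha> \<longleftrightarrow> 1 < \<alpha> \<and>
     (\<forall>S\<in>\<SS>. \<forall>K\<in>kube_ids S. \<forall>K'\<in>kube_ids S. kube_child \<theta> S K' K \<longrightarrow>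
        measure ball_vol (tent \<theta> S K) \<le> \<alpha> * measure ball_vol (tent \<theta> S K'))"


subsection \<open>Weight classes\<close>

definition uB1_const ::
  "real \<Rightarrow> ('n::finite) dyadic_structure set \<Rightarrow> (complex^'n \<Rightarrow> complex) \<Rightarrow> (complex^'n \<Rightarrow> real) \<Rightarrow> ennreal" where
  "uB1_const \<theta> \<SS> u \<sigma> = (SUP (S, K)\<in>all_kubes \<SS>.
     Linfty_norm (tent \<theta> S K) u * average (tent \<theta> S K) (\<lambda>z. ennreal (\<sigma> z))
       * Linfty_norm (tent \<theta> S K) (\<lambda>z. inverse (\<sigma> z)))"

definition maximal_fun ::
  "real \<Rightarrow> ('n::finite) dyadic_structure set \<Rightarrow> (complex^'n \<Rightarrow> real) \<Rightarrow> complex^'n \<Rightarrow> ennreal" where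
  "maximal_fun \<theta> \<SS> f z = (SUP (S, K)\<in>all_kubes \<SS>.
     average (tent \<theta> S K) (\<lambda>w. ennreal \<bar>f w\<bar>) * indicator (tent \<theta> S K) z)"

definition Binf_const ::
  "real \<Rightarrow> ('n::finite) dyadic_structure set \<Rightarrow> (complex^'n \<Rightarrow> real) \<Rightarrow> ennreal" where
  "Binf_const \<theta> \<SS> \<sigma> = (SUP (S, K)\<in>all_kubes \<SS>.
     (\<integral>\<^sup>+z\<in>tent \<theta> S K. maximal_fun \<theta> \<SS> (\<lambda>w. \<sigma> w * indicator (tent \<theta> S K) w) z \<partial>ball_vol)
       / weight_meas \<sigma> (tent \<theta> S K))"

definition uB1_class ::
  "real \<Rightarrow> ('n::finite) dyadic_structure set \<Rightarrow> (complex^'n \<Rightarrow> complex) \<Rightarrow> (complex^'n \<Rightarrow> real) set" where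
  "uB1_class \<theta> \<SS> u = {\<sigma>. weight \<sigma> \<and> uB1_const \<theta> \<SS> u \<sigma> < \<infinity>}"

definition Binf_class ::
  "real \<Rightarrow> ('n::finite) dyadic_structure set \<Rightarrow> (complex^'n \<Rightarrow> real) set" where
  "Binf_class \<theta> \<SS> = {\<sigma>. weight \<sigma> \<and> Binf_const \<theta> \<SS> \<sigma> < \<infinity>}"

end

theory Submission
  imports Defs "HOL-Probability.Probability_Measure"
begin

text \<open>
  The kernel \<open>1 / (1 - herm z w) ^ (n + 1)\<close> has absolute value at most a constant times \<open>1 / |T|\<close>
  for some dyadic tent \<open>T\<close> containing both points (\<open>kernel_le_tent\<close>): two points of the ball lie in
  a Carleson tent of height comparable to \<open>norm (1 - herm z w)\<close>, a tent of height \<open>r\<close> has volume of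
  order at most \<open>r ^ (n + 1)\<close>, and it is contained in a dyadic tent of comparable volume.  So
  \<open>|T\<^sub>u f|\<close> is dominated, up to a constant, by the sum of the averages of \<open>|u f|\<close> over the dyadic
  tents that contain the point (\<open>toeplitz_le_sparse_sum\<close>).  The tents of one structure form a laminar
  family, and each contains a substantial part, its kube, that is disjoint from all other kubes.

  The two weight conditions enter only through four measures: the volume \<open>\<mu>\<close>, the weight
  \<open>\<nu> = \<sigma> \<mu>\<close>, \<open>\<gamma> = |u f| \<mu>\<close> and \<open>\<eta> = |f| \<sigma> \<mu>\<close>.  The \<open>uB\<^sub>1\<close> condition gives
  \<open>\<gamma>(F) \<nu>(T) \<le> U \<mu>(T) \<eta>(F)\<close> for all \<open>F \<subseteq> T\<close> (\<open>testing_condition\<close>).  The \<open>B\<^sub>\<infinity>\<close> condition gives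
  a Carleson packing condition for the weight itself, with a constant \<open>P\<close> comparable to
  \<open>[\<sigma>]\<close> in \<open>B\<^sub>\<infinity>\<close>: the \<open>\<nu>\<close>-measures of the tents inside \<open>T\<close> add up to at most \<open>P \<nu>(T)\<close>
  (\<open>packing_condition\<close>), since on the kube of a tent the maximal function is at least the
  average over that tent, and the kubes are disjoint.

  What remains is a weak-type estimate for sparse averaging operators in terms of \<open>U\<close> and \<open>P\<close>
  (\<open>weak_type_sparse_operator\<close>).  At level \<open>l\<close>, the tents with average above \<open>l\<close> are handled by
  the testing condition.  The others are sorted by the size of their averages into the classes
  \<open>l / 16 ^ (k + 1) < avg \<le> l / 16 ^ k\<close>.  Within one class, at least half of the \<open>\<gamma>\<close>-mass of a
  tent sits on its shallow part, where few smaller tents of the class overlap; the shallow parts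
  have bounded overlap, so each class costs a multiple of \<open>U \<eta>\<close>.  This is spent on the first
  \<open>log P\<close> classes.  In the later classes the averages are so small that a point of the level set
  lies in very many tents of one class, and the packing condition bounds the second moment of
  that number; the resulting bounds decrease geometrically in \<open>k\<close>, and their sum is again a multiple
  of \<open>U \<eta>\<close>.

  This yields the bound \<open>C U log (e + [\<sigma>])\<close>, and the factor with the constant \<open>c\<close> of the
  hypothesis on kubes is at least \<open>1\<close> because \<open>c \<ge> 1\<close> (\<open>kube_constant_ge_1\<close>).
\<close>

section \<open>Finite laminar families\<close>

definition laminar :: "'a set set \<Rightarrow> bool" where
  "laminar \<G> \<longleftrightarrow> (\<forall>G\<in>\<G>. \<forall>H\<in>\<G>. G \<inter> H = {} \<or> G \<subseteq> H \<or> H \<subseteq> G)"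

lemma laminarD: "laminar \<G> \<Longrightarrow> G \<in> \<G> \<Longrightarrow> H \<in> \<G> \<Longrightarrow> G \<inter> H = {} \<or> G \<subseteq> H \<or> H \<subseteq> G"
  by (auto simp: laminar_def)

lemma laminar_mono: "laminar \<G> \<Longrightarrow> \<H> \<subseteq> \<G> \<Longrightarrow> laminar \<H>"
  unfolding laminar_def by blast

lemma laminar_disjoint_cover:
  assumes fin: "finite \<G>" and lam: "laminar \<G>"
  obtains \<H> where "\<H> \<subseteq> \<G>" "pairwise disjnt \<H>" "\<Union>\<H> = \<Union>\<G>"
proof
  let ?H = "{G \<in> \<G>. \<forall>H\<in>\<G>. G \<subseteq> H \<longrightarrow> G = H}"
  show "?H \<subseteq> \<G>" by auto
  show "pairwise disjnt ?H"
  proof (rule pairwiseI)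
    fix G H assume G: "G \<in> ?H" and H: "H \<in> ?H" and ne: "G \<noteq> H"
    then have "\<not> G \<subseteq> H" "\<not> H \<subseteq> G" by auto
    then show "disjnt G H" using laminarD[OF lam, of G H] G H by (auto simp: disjnt_def)
  qed
  show "\<Union>?H = \<Union>\<G>"
  proof (intro equalityI subsetI)
    fix x assume "x \<in> \<Union>\<G>"
    then obtain G where G: "G \<in> \<G>" "x \<in> G" by blast
    from finite_has_maximal2[OF fin G(1)]
    obtain H where "H \<in> \<G>" "G \<subseteq> H" "\<forall>B\<in>\<G>. H \<subseteq> B \<longrightarrow> H = B" by auto
    with G(2) show "x \<in> \<Union>?H" by blast
  qed auto
qed

text \<open>Only the maximal members matter for the union, and they are disjoint; so a comparison of
  two measures on the members carries over to the union without loss.\<close>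

lemma laminar_Union_measure_le:
  assumes M: "finite_measure M" and N: "finite_measure N" and eq: "sets N = sets M"
    and fin: "finite \<G>" and lam: "laminar \<G>" and sets: "\<G> \<subseteq> sets M"
    and le: "\<And>G. G \<in> \<G> \<Longrightarrow> measure N G \<le> s * measure M G"
  shows "measure N (\<Union>\<G>) \<le> s * measure M (\<Union>\<G>)"
proof -
  interpret M: finite_measure M by fact
  interpret N: finite_measure N by fact
  obtain \<H> where H: "\<H> \<subseteq> \<G>" "pairwise disjnt \<H>" "\<Union>\<H> = \<Union>\<G>"
    by (rule laminar_disjoint_cover[OF fin lam])
  have fH: "finite \<H>" using H(1) fin by (rule finite_subset)
  have "measure N (\<Union>\<H>) = (\<Sum>G\<in>\<H>. measure N G)"
    using fH H sets eq by (intro measure_Union') (auto simp: N.fmeasurable_eq_sets)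
  also have "\<dots> \<le> (\<Sum>G\<in>\<H>. s * measure M G)"
    using H(1) le by (intro sum_mono) auto
  also have "\<dots> = s * measure M (\<Union>\<H>)"
    using fH H sets
    by (subst measure_Union') (auto simp: M.fmeasurable_eq_sets sum_distrib_left)
  finally show ?thesis by (simp add: H(3))
qed

section \<open>Chebyshev bounds for sums of indicators\<close>

lemma (in finite_measure) measure_sum_indicator_gt:
  fixes c :: "'i \<Rightarrow> real"
  assumes fin: "finite J" and T: "\<And>j. j \<in> J \<Longrightarrow> T j \<in> sets M"
    and c: "\<And>j. j \<in> J \<Longrightarrow> 0 \<le> c j" and a: "0 < a"
  shows "a * measure M {z \<in> space M. a < (\<Sum>j\<in>J. c j * indicator (T j) z)}
      \<le> (\<Sum>j\<in>J. c j * measure M (T j))"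
proof -
  let ?f = "\<lambda>z. \<Sum>j\<in>J. c j * indicator (T j) z :: real"
  have meas[measurable]: "?f \<in> borel_measurable M"
    using T by (intro borel_measurable_sum) auto
  have int: "integrable M ?f"
    using T by (intro Bochner_Integration.integrable_sum integrable_mult_right
        integrable_real_indicator) (auto simp: emeasure_finite less_top[symmetric])
  have "measure M {z \<in> space M. a < ?f z} \<le> measure M {z \<in> space M. ?f z \<ge> a}"
    by (intro finite_measure_mono) auto
  also have "\<dots> \<le> (\<integral>z. ?f z \<partial>M) / a"
    using c a by (intro integral_Markov_inequality_measure[OF int, where A = "{}"])
      (auto intro!: sum_nonneg)
  also have "(\<integral>z. ?f z \<partial>M) = (\<Sum>j\<in>J. c j * measure M (T j))"
    using T by (subst Bochner_Integration.integral_sum)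
      (auto intro!: integrable_mult_right integrable_real_indicator
            simp: emeasure_finite less_top[symmetric] sets.Int_space_eq2)
  finally show ?thesis using a by (simp add: field_simps)
qed

definition overlap :: "('i \<Rightarrow> 'a set) \<Rightarrow> 'i set \<Rightarrow> 'a \<Rightarrow> nat" where
  "overlap T J z = card {j \<in> J. z \<in> T j}"

lemma overlap_eq_sum:
  assumes "finite J"
  shows "real (overlap T J z) = (\<Sum>j\<in>J. indicator (T j) z)"
  using assms by (simp add: overlap_def indicator_def sum.If_cases Int_def)

lemma overlap_measurable [measurable]:
  assumes "finite J" "\<And>j. j \<in> J \<Longrightarrow> T j \<in> sets M"
  shows "(\<lambda>z. real (overlap T J z)) \<in> borel_measurable M"
  unfolding overlap_eq_sum[OF assms(1)] using assms(2) by (intro borel_measurable_sum) auto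

lemma (in finite_measure) measure_overlap_gt:
  assumes "finite J" "\<And>j. j \<in> J \<Longrightarrow> T j \<in> sets M" "0 < a"
  shows "a * measure M {z \<in> space M. a < real (overlap T J z)} \<le> (\<Sum>j\<in>J. measure M (T j))"
  using measure_sum_indicator_gt[of J T "\<lambda>_. 1" a] assms by (simp add: overlap_eq_sum)

text \<open>For a laminar family the second moment of the overlap function is governed by the
  packing sums: of two members that meet, one contains the other.\<close>

lemma (in finite_measure) measure_overlap_gt_square:
  assumes fin: "finite J" and T: "\<And>j. j \<in> J \<Longrightarrow> T j \<in> sets M" and a: "0 < a"
    and lam: "laminar (T ` J)"
    and pack: "\<And>i. i \<in> J \<Longrightarrow> (\<Sum>j | j \<in> J \<and> T j \<subseteq> T i. measure M (T j)) \<le> P * measure M (T i)"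
  shows "a\<^sup>2 * measure M {z \<in> space M. a < real (overlap T J z)}
      \<le> 2 * P * (\<Sum>j\<in>J. measure M (T j))"
proof -
  let ?T = "\<lambda>(i, j). T i \<inter> T j"
  have sq: "(real (overlap T J z))\<^sup>2 = (\<Sum>p\<in>J \<times> J. 1 * indicator (?T p) z)" for z
  proof -
    have ind: "indicator (T (fst p) \<inter> T (snd p)) z = (indicator (T (fst p)) z * indicator (T (snd p)) z :: real)" for p
      by (auto simp: indicator_def case_prod_unfold)
    show ?thesis
      by (simp only: overlap_eq_sum[OF fin] power2_eq_square sum_product sum.cartesian_product
          ind mult_1 case_prod_unfold)
  qed
  have "{z \<in> space M. a < real (overlap T J z)}
      = {z \<in> space M. a\<^sup>2 < (\<Sum>p\<in>J \<times> J. 1 * indicator (?T p) z)}"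
    unfolding sq[symmetric] using a by (auto intro: power_strict_mono power_less_imp_less_base)
  then have "a\<^sup>2 * measure M {z \<in> space M. a < real (overlap T J z)}
      \<le> (\<Sum>p\<in>J \<times> J. 1 * measure M (?T p))"
    using measure_sum_indicator_gt[of "J \<times> J" ?T "\<lambda>_. 1" "a\<^sup>2"] fin T a by (auto simp: sets.Int)
  also have "\<dots> = (\<Sum>i\<in>J. \<Sum>j\<in>J. measure M (T i \<inter> T j))"
    by (simp add: sum.cartesian_product case_prod_unfold)
  also have "\<dots> \<le> (\<Sum>i\<in>J. \<Sum>j\<in>J. (if T j \<subseteq> T i then measure M (T j) else 0)
                               + (if T i \<subseteq> T j then measure M (T i) else 0))"
  proof (intro sum_mono)
    fix i j assume "i \<in> J" "j \<in> J"
    then have "T i \<inter> T j = {} \<or> T i \<subseteq> T j \<or> T j \<subseteq> T i"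
      using lam by (auto simp: laminar_def)
    then show "measure M (T i \<inter> T j) \<le> (if T j \<subseteq> T i then measure M (T j) else 0)
                               + (if T i \<subseteq> T j then measure M (T i) else 0)"
      by (auto simp: Int_absorb1 Int_absorb2)
  qed
  also have "\<dots> = (\<Sum>i\<in>J. \<Sum>j\<in>J. if T j \<subseteq> T i then measure M (T j) else 0)
               + (\<Sum>j\<in>J. \<Sum>i\<in>J. if T i \<subseteq> T j then measure M (T i) else 0)"
    by (simp add: sum.distrib sum.swap[of "\<lambda>i j. if T i \<subseteq> T j then measure M (T i) else 0"])
  also have "\<dots> = 2 * (\<Sum>i\<in>J. \<Sum>j | j \<in> J \<and> T j \<subseteq> T i. measure M (T j))"
    by (simp add: sum.If_cases[OF fin] Int_def conj_commute)
  also have "\<dots> \<le> 2 * (\<Sum>i\<in>J. P * measure M (T i))"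
    using pack by (intro mult_left_mono sum_mono) auto
  finally show ?thesis by (simp add: sum_distrib_left mult.assoc)
qed

section \<open>A weak-type estimate for sparse averaging operators\<close>

locale sparse_family = finite_measure \<mu> for \<mu> :: "'a measure" +
  fixes I :: "'i set" and T E :: "'i \<Rightarrow> 'a set" and A :: real
  assumes finite_I: "finite I"
    and T_sets: "i \<in> I \<Longrightarrow> T i \<in> sets \<mu>"
    and E_sets: "i \<in> I \<Longrightarrow> E i \<in> sets \<mu>"
    and E_disjoint: "disjoint_family_on E I"
    and E_subset: "i \<in> I \<Longrightarrow> E i \<subseteq> T i"
    and T_laminar: "laminar (T ` I)"
    and T_pos: "i \<in> I \<Longrightarrow> 0 < measure \<mu> (T i)"
    and sparse: "i \<in> I \<Longrightarrow> measure \<mu> (T i) \<le> A * measure \<mu> (E i)"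
    and A_ge_1: "1 \<le> A"
begin

lemma carleson_packing:
  assumes "J \<subseteq> I" "Q \<in> sets \<mu>"
  shows "(\<Sum>j | j \<in> J \<and> T j \<subseteq> Q. measure \<mu> (T j)) \<le> A * measure \<mu> Q"
proof -
  let ?K = "{j \<in> J. T j \<subseteq> Q}"
  have K: "?K \<subseteq> I" "finite ?K" using assms(1) finite_I by (auto intro: finite_subset)
  have "(\<Sum>j\<in>?K. measure \<mu> (T j)) \<le> (\<Sum>j\<in>?K. A * measure \<mu> (E j))"
    using K by (intro sum_mono sparse) auto
  also have "\<dots> = A * measure \<mu> (\<Union>j\<in>?K. E j)"
    using K E_sets disjoint_family_on_mono[OF K(1) E_disjoint]
    by (subst finite_measure_finite_Union) (auto simp: sum_distrib_left)
  also have "\<dots> \<le> A * measure \<mu> Q"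
  proof -
    have "(\<Union>j\<in>?K. E j) \<subseteq> Q" using K(1) E_subset by blast
    then show ?thesis
      using A_ge_1 assms(2) by (intro mult_left_mono finite_measure_mono) auto
  qed
  finally show ?thesis .
qed

text \<open>The points covered more than \<open>t\<close> times by members inside \<open>Q\<close> form a union of members:
  if \<open>Q\<close> is covered more than \<open>t\<close> times at a point, then so is every point of
  the smallest member that contains the given one.\<close>

lemma deep_part_eq_Union:
  fixes Q :: "'a set"
  assumes "J \<subseteq> I" "0 \<le> t"
  defines "D \<equiv> {z \<in> space \<mu>. t < real (overlap T {j \<in> J. T j \<subseteq> Q} z)}"
  shows "D = \<Union>(T ` {j \<in> J. T j \<subseteq> Q \<and> T j \<subseteq> D})"
proof (intro equalityI subsetI)
  fix z assume z: "z \<in> D"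
  let ?C = "{j \<in> J. T j \<subseteq> Q \<and> z \<in> T j}"
  have finJ: "finite J" using assms(1) finite_I by (rule finite_subset)
  have "t < real (card ?C)" using z by (simp add: D_def overlap_def conj_assoc)
  then have "?C \<noteq> {}" using assms(2) by (metis card.empty not_le of_nat_0)
  then have "T ` ?C \<noteq> {}" "finite (T ` ?C)" using finJ by auto
  then obtain X where "X \<in> T ` ?C" and min: "\<forall>Y\<in>T ` ?C. Y \<subseteq> X \<longrightarrow> X = Y"
    using finite_has_minimal[of "T ` ?C"] by blast
  then obtain i where i: "i \<in> J" "T i \<subseteq> Q" "z \<in> T i" "X = T i" by auto
  have sub: "T i \<subseteq> T j" if "j \<in> ?C" for j
  proof -
    have "T i \<inter> T j \<noteq> {}" using that i by auto
    then have "T i \<subseteq> T j \<or> T j \<subseteq> T i"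
      using laminarD[OF T_laminar, of "T i" "T j"] that i assms(1) by auto
    then show ?thesis using min that i by auto
  qed
  have "T i \<subseteq> D"
  proof
    fix w assume w: "w \<in> T i"
    then have "w \<in> space \<mu>" using i assms(1) T_sets sets.sets_into_space by blast
    moreover have "card ?C \<le> card {j \<in> {j \<in> J. T j \<subseteq> Q}. w \<in> T j}"
      using finJ sub w by (intro card_mono) auto
    ultimately show "w \<in> D" using \<open>t < real (card ?C)\<close> by (auto simp: D_def overlap_def)
  qed
  then show "z \<in> \<Union>(T ` {j \<in> J. T j \<subseteq> Q \<and> T j \<subseteq> D})" using i by auto
qed auto

end

text \<open>A point lies in at most \<open>t\<close> members of a laminar family in which it has depth at
  most \<open>t\<close>: these members form a chain, and the largest of them sees all the others.\<close>

lemma card_shallow_le: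
  assumes fin: "finite J" and lam: "laminar (T ` J)" and t: "0 \<le> t"
  shows "real (card {i \<in> J. z \<in> T i \<and> real (overlap T {j \<in> J. T j \<subseteq> T i} z) \<le> t}) \<le> t"
    (is "real (card ?S) \<le> t")
proof (cases "?S = {}")
  case True
  then show ?thesis using t by (simp only: card.empty)
next
  case False
  then have "finite (T ` ?S)" "T ` ?S \<noteq> {}" using fin by auto
  then obtain X where X: "X \<in> T ` ?S" and max: "\<forall>Y\<in>T ` ?S. X \<subseteq> Y \<longrightarrow> X = Y"
    using finite_has_maximal[of "T ` ?S"] by blast
  from X obtain i where i: "i \<in> ?S" "X = T i" by blast
  have "?S \<subseteq> {j \<in> {j \<in> J. T j \<subseteq> T i}. z \<in> T j}"
  proof
    fix j assume j: "j \<in> ?S"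
    have "T i \<inter> T j \<noteq> {}" using i j by auto
    then have "T i \<subseteq> T j \<or> T j \<subseteq> T i"
      using laminarD[OF lam, of "T i" "T j"] i j by auto
    then have "T j \<subseteq> T i" using max i j by auto
    then show "j \<in> {j \<in> {j \<in> J. T j \<subseteq> T i}. z \<in> T j}" using j by auto
  qed
  then have "card ?S \<le> overlap T {j \<in> J. T j \<subseteq> T i} z"
    unfolding overlap_def using fin by (intro card_mono) auto
  then show ?thesis using i by auto
qed

text \<open>The model is \<open>\<nu> = \<sigma> \<mu>\<close>, \<open>\<gamma> = g \<mu>\<close> and \<open>\<eta> = h \<sigma> \<mu>\<close>, where \<open>g\<close> is the function that is
  averaged.  In terms of densities the testing condition reads \<open>g \<langle>\<sigma>\<rangle>\<^sub>T \<le> U h \<sigma>\<close> on \<open>T\<close>.\<close>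

locale weighted_sparse_family = sparse_family \<mu> I T E A
  for \<mu> :: "'a measure" and I :: "'i set" and T E A +
  fixes \<nu> \<gamma> \<eta> :: "'a measure" and U P :: real
  assumes finite_measures: "finite_measure \<nu>" "finite_measure \<gamma>" "finite_measure \<eta>"
    and sets_eq: "sets \<nu> = sets \<mu>" "sets \<gamma> = sets \<mu>" "sets \<eta> = sets \<mu>"
    and U_nonneg: "0 \<le> U"
    and testing: "\<And>i F. i \<in> I \<Longrightarrow> F \<in> sets \<mu> \<Longrightarrow> F \<subseteq> T i \<Longrightarrow>
        measure \<gamma> F * measure \<nu> (T i) \<le> U * measure \<mu> (T i) * measure \<eta> F"
    and packing: "\<And>i. i \<in> I \<Longrightarrow>
        (\<Sum>j | j \<in> I \<and> T j \<subseteq> T i. measure \<nu> (T j)) \<le> P * measure \<nu> (T i)"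
begin

sublocale nu: finite_measure \<nu> by (rule finite_measures)
sublocale gam: finite_measure \<gamma> by (rule finite_measures)
sublocale eta: finite_measure \<eta> by (rule finite_measures)

definition avg :: "'i \<Rightarrow> real" where
  "avg i = measure \<gamma> (T i) / measure \<mu> (T i)"

lemma avg_nonneg: "0 \<le> avg i"
  by (simp add: avg_def)

lemma space_eq: "space \<nu> = space \<mu>" "space \<gamma> = space \<mu>" "space \<eta> = space \<mu>"
  using sets_eq by (auto dest: sets_eq_imp_space_eq)

lemma T_sets': "i \<in> I \<Longrightarrow> T i \<in> sets \<nu>" "i \<in> I \<Longrightarrow> T i \<in> sets \<gamma>" "i \<in> I \<Longrightarrow> T i \<in> sets \<eta>"
  using T_sets sets_eq by auto

text \<open>On a level set of the averages, the mass that \<open>\<gamma>\<close> puts on the deep part of a member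
  (the points covered more than \<open>2 * q * A\<close> times from inside) is at most half of its mass on
  that member: by Chebyshev the deep part is small, and it is a union of members with
  comparable averages.\<close>

lemma gamma_deep_part_le_half:
  assumes J: "J \<subseteq> I" and s: "0 < s" "0 < q" and i: "i \<in> J"
    and avg: "\<And>j. j \<in> J \<Longrightarrow> s / q < avg j \<and> avg j \<le> s"
  defines "D \<equiv> {z \<in> space \<mu>. 2 * q * A < real (overlap T {j \<in> J. T j \<subseteq> T i} z)}"
  shows "D \<in> sets \<mu>" "measure \<gamma> D \<le> measure \<gamma> (T i) / 2"
proof -
  let ?t = "2 * q * A"
  let ?K = "{j \<in> J. T j \<subseteq> T i}"
  have finJ: "finite J" using J finite_I by (rule finite_subset)
  have t: "0 < ?t" using s A_ge_1 by simp
  have iI: "i \<in> I" using i J by auto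
  have [measurable]: "(\<lambda>z. real (overlap T ?K z)) \<in> borel_measurable \<mu>"
    using finJ J T_sets by (intro overlap_measurable) auto
  show D: "D \<in> sets \<mu>" unfolding D_def by measurable
  have "?t * measure \<mu> D \<le> (\<Sum>j\<in>?K. measure \<mu> (T j))"
    unfolding D_def using finJ J T_sets t by (intro measure_overlap_gt) auto
  also have "\<dots> \<le> A * measure \<mu> (T i)"
    using carleson_packing[OF J T_sets[OF iI]] by simp
  finally have "A * (2 * q * measure \<mu> D) \<le> A * measure \<mu> (T i)" by (simp add: mult_ac)
  then have *: "2 * q * measure \<mu> D \<le> measure \<mu> (T i)"
    using A_ge_1 by simp
  let ?G = "T ` {j \<in> J. T j \<subseteq> T i \<and> T j \<subseteq> D}"
  have DG: "D = \<Union>?G"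
    unfolding D_def using J t by (intro deep_part_eq_Union) auto
  have "measure \<gamma> (\<Union>?G) \<le> s * measure \<mu> (\<Union>?G)"
  proof (rule laminar_Union_measure_le)
    show "laminar ?G" by (rule laminar_mono[OF T_laminar]) (use J in auto)
    fix G assume "G \<in> ?G"
    then obtain j where j: "j \<in> J" "G = T j" by auto
    then have "0 < measure \<mu> (T j)" using T_pos J by auto
    then show "measure \<gamma> G \<le> s * measure \<mu> G"
      using avg[OF j(1)] j by (simp add: avg_def field_simps)
  qed (use J finJ T_sets sets_eq in \<open>auto intro: finite_measures finite_measure_axioms\<close>)
  then have "measure \<gamma> D \<le> s * measure \<mu> D" using DG by simp
  also have "s * measure \<mu> D \<le> s * (measure \<mu> (T i) / (2 * q))"
    using * s by (intro mult_left_mono) (auto simp: field_simps)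
  also have "\<dots> = s / q * measure \<mu> (T i) / 2" by simp
  also have "s / q * measure \<mu> (T i) \<le> measure \<gamma> (T i)"
    using avg[OF i] T_pos[OF iI] by (simp add: avg_def pos_less_divide_eq)
  finally show "measure \<gamma> D \<le> measure \<gamma> (T i) / 2" by simp
qed

text \<open>Hence on one level set the testing condition may be applied on the shallow parts of the
  members only, and these overlap boundedly.\<close>

lemma level_set_sum_le:
  assumes J: "J \<subseteq> I" and s: "0 < s" "0 < q"
    and avg: "\<And>j. j \<in> J \<Longrightarrow> s / q < avg j \<and> avg j \<le> s"
  shows "(\<Sum>i\<in>J. avg i * measure \<nu> (T i)) \<le> 4 * q * A * U * measure \<eta> (space \<mu>)"
proof -
  let ?t = "2 * q * A"
  define D where "D i = {z \<in> space \<mu>. ?t < real (overlap T {j \<in> J. T j \<subseteq> T i} z)}" for i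
  define F where "F i = T i - D i" for i
  have finJ: "finite J" using J finite_I by (rule finite_subset)
  have t: "0 < ?t" using s A_ge_1 by simp
  have D: "D i \<in> sets \<mu>" "measure \<gamma> (D i) \<le> measure \<gamma> (T i) / 2" if "i \<in> J" for i
    using gamma_deep_part_le_half[OF J s that avg] by (auto simp: D_def)
  have F: "F i \<in> sets \<mu>" if "i \<in> J" for i
    using D(1)[OF that] T_sets that J by (auto simp: F_def)
  have single: "avg i * measure \<nu> (T i) \<le> 2 * U * measure \<eta> (F i)" if i: "i \<in> J" for i
  proof -
    have iI: "i \<in> I" using i J by auto
    have "measure \<gamma> (T i) \<le> measure \<gamma> (F i \<union> D i)"
    proof (rule gam.finite_measure_mono)
      show "F i \<union> D i \<in> sets \<gamma>" using F[OF i] D(1)[OF i] sets_eq by simp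
    qed (auto simp: F_def)
    also have "\<dots> \<le> measure \<gamma> (F i) + measure \<gamma> (D i)"
      using F D i sets_eq by (intro measure_Un_le) auto
    finally have "measure \<gamma> (T i) \<le> 2 * measure \<gamma> (F i)" using D(2)[OF i] by simp
    then have "measure \<gamma> (T i) * measure \<nu> (T i) \<le> 2 * (measure \<gamma> (F i) * measure \<nu> (T i))"
      using mult_right_mono[of "measure \<gamma> (T i)" "2 * measure \<gamma> (F i)" "measure \<nu> (T i)"]
      by (simp add: mult.assoc)
    also have "\<dots> \<le> 2 * (U * measure \<mu> (T i) * measure \<eta> (F i))"
      using testing[OF iI F[OF i]] by (simp add: F_def)
    finally show ?thesis using T_pos[OF iI] by (simp add: avg_def field_simps)
  qed
  have total: "(\<Sum>i\<in>J. measure \<eta> (F i)) \<le> ?t * measure \<eta> (space \<mu>)"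
  proof -
    have int: "integrable \<eta> (indicator (F i) :: _ \<Rightarrow> real)" if "i \<in> J" for i
      using F[OF that] sets_eq
      by (intro integrable_real_indicator) (auto simp: eta.emeasure_finite less_top[symmetric])
    have "(\<Sum>i\<in>J. measure \<eta> (F i)) = (\<integral>z. (\<Sum>i\<in>J. indicator (F i) z) \<partial>\<eta>)"
      using F sets_eq
      by (subst Bochner_Integration.integral_sum[OF int])
         (auto simp: sets.Int_space_eq2 intro!: sum.cong)
    also have "\<dots> \<le> (\<integral>z. ?t \<partial>\<eta>)"
    proof (rule integral_mono)
      fix z assume "z \<in> space \<eta>"
      have "(\<Sum>i\<in>J. indicator (F i) z) = real (card {i \<in> J. z \<in> F i})"
        using finJ by (simp add: indicator_def sum.If_cases Int_def)
      also have "{i \<in> J. z \<in> F i}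
          = {i \<in> J. z \<in> T i \<and> real (overlap T {j \<in> J. T j \<subseteq> T i} z) \<le> ?t}"
        using \<open>z \<in> space \<eta>\<close> by (auto simp: F_def D_def space_eq)
      also have "real (card \<dots>) \<le> ?t"
        using finJ t laminar_mono[OF T_laminar, of "T ` J"] J by (intro card_shallow_le) auto
      finally show "(\<Sum>i\<in>J. indicator (F i) z) \<le> ?t" .
    qed (auto intro!: Bochner_Integration.integrable_sum int)
    finally show ?thesis by (simp add: space_eq mult_ac)
  qed
  have "(\<Sum>i\<in>J. avg i * measure \<nu> (T i)) \<le> (\<Sum>i\<in>J. 2 * U * measure \<eta> (F i))"
    by (rule sum_mono[OF single])
  also have "\<dots> = 2 * U * (\<Sum>i\<in>J. measure \<eta> (F i))" by (simp add: sum_distrib_left)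
  also have "\<dots> \<le> 2 * U * (?t * measure \<eta> (space \<mu>))"
    using total U_nonneg by (intro mult_left_mono) auto
  finally show ?thesis by (simp add: mult_ac)
qed


text \<open>Members whose average exceeds the level: the testing condition bounds their \<open>\<nu>\<close>-mass
  directly, and a laminar family is as good as a disjoint one.\<close>

lemma large_average_bound:
  assumes l: "0 < l"
  shows "l * measure \<nu> (\<Union>(T ` {i \<in> I. l < avg i})) \<le> U * measure \<eta> (space \<mu>)"
proof -
  let ?G = "T ` {i \<in> I. l < avg i}"
  have "measure \<nu> (\<Union>?G) \<le> U / l * measure \<eta> (\<Union>?G)"
  proof (rule laminar_Union_measure_le)
    show "laminar ?G" by (rule laminar_mono[OF T_laminar]) auto
    fix G assume "G \<in> ?G"
    then obtain i where i: "i \<in> I" "l < avg i" "G = T i" by auto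
    have "l * measure \<nu> (T i) \<le> avg i * measure \<nu> (T i)"
      using i by (intro mult_right_mono) auto
    also have "\<dots> \<le> U * measure \<eta> (T i)"
      using testing[OF i(1) T_sets[OF i(1)]] T_pos[OF i(1)] by (simp add: avg_def field_simps)
    finally show "measure \<nu> G \<le> U / l * measure \<eta> G" using l i by (simp add: field_simps)
  qed (use finite_I T_sets sets_eq finite_measures in auto)
  also have "\<dots> \<le> U / l * measure \<eta> (space \<mu>)"
    using l U_nonneg eta.bounded_measure[of "\<Union>?G"] by (intro mult_left_mono) (auto simp: space_eq)
  finally show ?thesis using l by (simp add: field_simps)
qed

text \<open>A class of small averages can only produce a large sum where many members overlap.  The
  packing of \<open>\<nu>\<close> bounds the second moment of the overlap, at the price of a factor \<open>P\<close>, which the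
  starting index \<open>m\<close> absorbs.  With the ratio \<open>16\<close> between classes there is room for the
  share \<open>(1/2) ^ i / 4\<close> of the level to decrease while the bound still decays geometrically.\<close>

lemma small_average_bound:
  assumes l: "0 < l" and P: "P \<le> 16 ^ m" and J: "J \<subseteq> I"
    and avg: "\<And>j. j \<in> J \<Longrightarrow> l / 16 ^ (m + i) / 16 < avg j \<and> avg j \<le> l / 16 ^ (m + i)"
  shows "l * measure \<nu> {z \<in> space \<mu>. (1/2) ^ i / 4 * l < (\<Sum>j\<in>J. avg j * indicator (T j) z)}
      \<le> 32768 * A * U * measure \<eta> (space \<mu>) * (1/4) ^ i"
    (is "l * measure \<nu> ?Y \<le> _")
proof -
  \<comment> \<open>the number of members that a point of the level set must lie in:
    \<open>(1/2) ^ i / 4\<close> divided by the largest possible \<open>avg j / l\<close>, which is \<open>1 / 16 ^ (m + i)\<close>\<close>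
  define a :: real where "a = 16 ^ m * 8 ^ i / 4"
  define H where "H = measure \<eta> (space \<mu>)"
  define N where "N = measure \<nu> {z \<in> space \<nu>. a < real (overlap T J z)}"
  define S where "S = (\<Sum>j\<in>J. measure \<nu> (T j))"
  have finJ: "finite J" using J finite_I by (rule finite_subset)
  have a: "0 < a" by (simp add: a_def)
  have S0: "0 \<le> S" by (auto simp: S_def intro: sum_nonneg)
  have "?Y \<subseteq> {z \<in> space \<nu>. a < real (overlap T J z)}"
  proof
    fix z assume z: "z \<in> ?Y"
    then have "(1/2) ^ i / 4 * l < (\<Sum>j\<in>J. avg j * indicator (T j) z)" by simp
    also have "\<dots> \<le> (\<Sum>j\<in>J. l / 16 ^ (m + i) * indicator (T j) z)"
      using avg by (intro sum_mono mult_right_mono) auto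
    also have "\<dots> = l / 16 ^ (m + i) * real (overlap T J z)"
      by (simp add: overlap_eq_sum[OF finJ] sum_distrib_left)
    finally have "(1/2) ^ i / 4 * 16 ^ (m + i) < real (overlap T J z)"
      using l by (simp add: field_simps)
    moreover have "(1/2) ^ i / 4 * 16 ^ (m + i) = a"
    proof -
      have "(16::real) ^ i = 2 ^ i * 8 ^ i" by (simp flip: power_mult_distrib)
      then show ?thesis by (simp add: a_def power_add power_divide)
    qed
    ultimately show "z \<in> {z \<in> space \<nu>. a < real (overlap T J z)}"
      using z by (simp add: space_eq)
  qed
  moreover have "{z \<in> space \<nu>. a < real (overlap T J z)} \<in> sets \<nu>"
  proof -
    have [measurable]: "(\<lambda>z. real (overlap T J z)) \<in> borel_measurable \<nu>"
      using finJ J T_sets' by (intro overlap_measurable) auto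
    show ?thesis by measurable
  qed
  ultimately have "measure \<nu> ?Y \<le> N" unfolding N_def by (rule nu.finite_measure_mono)
  have sq: "a\<^sup>2 * N \<le> 2 * P * S"
    unfolding N_def S_def
  proof (rule nu.measure_overlap_gt_square)
    show "laminar (T ` J)" by (rule laminar_mono[OF T_laminar]) (use J in auto)
    fix i assume "i \<in> J"
    have "(\<Sum>j | j \<in> J \<and> T j \<subseteq> T i. measure \<nu> (T j)) \<le> (\<Sum>j | j \<in> I \<and> T j \<subseteq> T i. measure \<nu> (T j))"
      using J finite_I by (intro sum_mono2) auto
    also have "\<dots> \<le> P * measure \<nu> (T i)" using \<open>i \<in> J\<close> J by (intro packing) auto
    finally show "(\<Sum>j | j \<in> J \<and> T j \<subseteq> T i. measure \<nu> (T j)) \<le> P * measure \<nu> (T i)" .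
  qed (use finJ J T_sets' a in auto)
  have "l / 16 ^ (m + i) / 16 * S \<le> (\<Sum>j\<in>J. avg j * measure \<nu> (T j))"
    unfolding S_def sum_distrib_left using avg by (intro sum_mono mult_right_mono) (auto simp: less_imp_le)
  also have "\<dots> \<le> 4 * 16 * A * U * H"
    unfolding H_def using l avg by (intro level_set_sum_le[OF J, of "l / 16 ^ (m + i)"]) auto
  finally have S: "l * S \<le> 1024 * 16 ^ (m + i) * (A * U * H)" by (simp add: field_simps)
  have "a\<^sup>2 * (l * N) \<le> 2 * 16 ^ m * (l * S)"
  proof -
    have "a\<^sup>2 * (l * N) \<le> l * (2 * P * S)" using sq l by (simp add: mult.left_commute)
    also have "\<dots> \<le> l * (2 * 16 ^ m * S)"
      using P l S0 by (intro mult_left_mono mult_right_mono) auto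
    finally show ?thesis by (simp add: mult_ac)
  qed
  also have "\<dots> \<le> 2 * 16 ^ m * (1024 * 16 ^ (m + i) * (A * U * H))"
    using S by (intro mult_left_mono) auto
  also have "\<dots> = a\<^sup>2 * (32768 * (A * U * H) * (1/4) ^ i)"
  proof -
    have "(8 ^ i)\<^sup>2 = (4 ^ i * 16 ^ i :: real)"
      by (simp add: power2_eq_square flip: power_mult_distrib)
    then have a2: "a\<^sup>2 = 16 ^ m * 16 ^ m * (4 ^ i * 16 ^ i) / 16"
      by (simp add: a_def power_mult_distrib power_divide) (simp add: power2_eq_square)
    show ?thesis unfolding a2 by (simp add: power_add power_divide)
  qed
  finally have "l * N \<le> 32768 * (A * U * H) * (1/4) ^ i"
    using a by (simp only: mult_le_cancel_left_pos zero_less_power)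
  moreover have "l * measure \<nu> ?Y \<le> l * N"
    using \<open>measure \<nu> ?Y \<le> N\<close> l by simp
  ultimately show ?thesis by (simp add: H_def mult_ac)
qed

text \<open>The level \<open>l\<close> is split among the classes: half of it goes to the first \<open>m\<close> classes
  together, and the shares \<open>(1/2) ^ i / 4\<close> of the later ones add up to at most the other half.  The
  first \<open>m\<close> classes are estimated in \<open>L\<^sup>1\<close>, which makes \<open>m\<close> enter linearly.\<close>

theorem weak_type_sparse_operator:
  assumes l: "0 < l" and P: "P \<le> 16 ^ m"
  shows "l * measure \<nu> {z \<in> space \<mu>. l < (\<Sum>i\<in>I. avg i * indicator (T i) z)}
      \<le> (1 + 128 * A * real m + 65536 * A) * U * measure \<eta> (space \<mu>)"
proof -
  define H where "H = measure \<eta> (space \<mu>)"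
  define J where "J k = {i \<in> I. l / 16 ^ k / 16 < avg i \<and> avg i \<le> l / 16 ^ k}" for k :: nat
  define f where "f k z = (\<Sum>j\<in>J k. avg j * indicator (T j) z :: real)" for k z
  define Big where "Big = \<Union>(T ` {i \<in> I. l < avg i})"
  define X where "X = {z \<in> space \<nu>. l / 2 < (\<Sum>p\<in>(SIGMA k:{..<m}. J k). avg (snd p) * indicator (T (snd p)) z)}"
  define Y where "Y i = {z \<in> space \<mu>. (1/2) ^ i / 4 * l < f (m + i) z}" for i
  have J: "J k \<subseteq> I" "finite (J k)" for k using finite_I by (auto simp: J_def)
  have H: "0 \<le> A * U * H" using A_ge_1 U_nonneg by (simp add: H_def)
  have fmeas[measurable]: "f k \<in> borel_measurable \<nu>" for k
    unfolding f_def using J T_sets' by (intro borel_measurable_sum) (auto simp: subset_iff)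

  \<comment> \<open>as \<open>I\<close> is finite, finitely many classes contain all members with average in \<open>(0, l]\<close>\<close>
  have "\<exists>n. \<forall>i\<in>I. 0 < avg i \<and> avg i \<le> l \<longrightarrow> (\<exists>k<m+n. i \<in> J k)"
  proof -
    have "\<exists>k. i \<in> J k" if i: "i \<in> I" "0 < avg i" "avg i \<le> l" for i
    proof -
      let ?Q = "\<lambda>k. l / 16 ^ k / 16 < avg i"
      obtain k where "l / avg i < 16 ^ k" using real_arch_pow[of 16 "l / avg i"] by auto
      then have "?Q k" using i by (auto simp: field_simps)
      then have Q: "?Q (LEAST k. ?Q k)" by (rule LeastI)
      have "avg i \<le> l / 16 ^ (LEAST k. ?Q k)"
      proof (cases "LEAST k. ?Q k")
        case 0
        then show ?thesis using i by (simp only: power_0 div_by_1)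
      next
        case (Suc k)
        then have "\<not> ?Q k" using not_less_Least[of k ?Q] by simp
        then show ?thesis unfolding Suc by (simp add: field_simps)
      qed
      with Q i show ?thesis by (auto simp: J_def)
    qed
    then obtain kk where kk: "\<And>i. i \<in> I \<Longrightarrow> 0 < avg i \<Longrightarrow> avg i \<le> l \<Longrightarrow> i \<in> J (kk i)" by metis
    have "kk i < m + Suc (Max (kk ` I))" if "i \<in> I" for i
      using that finite_I by (intro trans_less_add2 le_imp_less_Suc Max_ge) auto
    then show ?thesis using kk by metis
  qed
  then obtain n where n: "\<And>i. i \<in> I \<Longrightarrow> 0 < avg i \<Longrightarrow> avg i \<le> l \<Longrightarrow> \<exists>k<m+n. i \<in> J k" by metis

  have cover: "{z \<in> space \<mu>. l < (\<Sum>i\<in>I. avg i * indicator (T i) z)} \<subseteq> Big \<union> X \<union> (\<Union>i<n. Y i)"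
  proof (rule subsetI, rule ccontr)
    fix z assume z: "z \<in> {z \<in> space \<mu>. l < (\<Sum>i\<in>I. avg i * indicator (T i) z)}"
      and nz: "z \<notin> Big \<union> X \<union> (\<Union>i<n. Y i)"
    have "(\<Sum>i\<in>I. avg i * indicator (T i) z)
        \<le> (\<Sum>i\<in>I. \<Sum>k<m+n. if i \<in> J k then avg i * indicator (T i) z else 0)"
    proof (rule sum_mono)
      fix i assume i: "i \<in> I"
      show "avg i * indicator (T i) z
          \<le> (\<Sum>k<m+n. if i \<in> J k then avg i * indicator (T i) z else 0)" (is "?a \<le> ?s")
      proof (cases "?a = 0")
        case True
        moreover have "0 \<le> ?s" by (intro sum_nonneg) (auto simp: avg_nonneg)
        ultimately show ?thesis by linarith
      next
        case False
        then have zi: "z \<in> T i" "avg i \<noteq> 0" by (auto split: split_indicator_asm)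
        with avg_nonneg[of i] have "0 < avg i" by simp
        have "avg i \<le> l" using nz zi i by (force simp: Big_def)
        from n[OF i \<open>0 < avg i\<close> this] obtain k where k: "k < m + n" "i \<in> J k" by auto
        have "?a = (if i \<in> J k then ?a else 0)" using k by simp
        also have "\<dots> \<le> ?s"
          using k by (intro member_le_sum) (auto simp: avg_nonneg)
        finally show ?thesis .
      qed
    qed
    also have "\<dots> = (\<Sum>k<m+n. \<Sum>i\<in>I. if i \<in> J k then avg i * indicator (T i) z else 0)"
      by (rule sum.swap)
    also have "\<dots> = (\<Sum>k<m+n. f k z)"
      unfolding f_def using finite_I J
      by (intro sum.cong[OF refl]) (simp add: sum.inter_restrict[OF finite_I, symmetric] Int_absorb1)
    also have "\<dots> = (\<Sum>k<m. f k z) + (\<Sum>i<n. f (m + i) z)"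
      by (induction n) auto
    also have "\<dots> \<le> l / 2 + (\<Sum>i<n. (1/2) ^ i / 4 * l)"
    proof (intro add_mono sum_mono)
      have "z \<in> space \<nu>" using z by (simp add: space_eq)
      moreover have "(\<Sum>p\<in>(SIGMA k:{..<m}. J k). avg (snd p) * indicator (T (snd p)) z)
          = (\<Sum>k<m. f k z)"
        unfolding f_def using J by (subst sum.Sigma) (auto simp: case_prod_unfold)
      ultimately show "(\<Sum>k<m. f k z) \<le> l / 2" using nz by (auto simp: X_def)
      fix i assume "i \<in> {..<n}"
      then show "f (m + i) z \<le> (1/2) ^ i / 4 * l"
        using nz z by (auto simp: Y_def not_less)
    qed
    also have "(\<Sum>i<n. (1/2) ^ i / 4 * l) \<le> l / 2"
    proof -
      have "(\<Sum>i<n. (1/2) ^ i / 4 * l) = (\<Sum>i<n. (1/2) ^ i) * (l / 4)"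
        by (simp add: sum_distrib_right)
      also have "(\<Sum>i<n. (1/2::real) ^ i) \<le> 2"
        by (subst sum_gp_strict) (auto simp: field_simps)
      finally show ?thesis using l by simp
    qed
    finally show False using z by simp
  qed

  have Big: "l * measure \<nu> Big \<le> U * H"
    unfolding Big_def H_def by (rule large_average_bound[OF l])
  have X: "l * measure \<nu> X \<le> 128 * real m * (A * U * H)"
  proof -
    have "l / 2 * measure \<nu> X \<le> (\<Sum>p\<in>(SIGMA k:{..<m}. J k). avg (snd p) * measure \<nu> (T (snd p)))"
      unfolding X_def using J T_sets' l
      by (intro nu.measure_sum_indicator_gt) (auto simp: avg_nonneg subset_iff)
    also have "\<dots> = (\<Sum>k<m. \<Sum>j\<in>J k. avg j * measure \<nu> (T j))"
      using J by (subst sum.Sigma) (auto simp: case_prod_unfold)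
    also have "\<dots> \<le> (\<Sum>k<m. 4 * 16 * A * U * H)"
      unfolding H_def using l
      by (intro sum_mono level_set_sum_le[OF J(1), where s = "l / 16 ^ _"]) (auto simp: J_def)
    finally show ?thesis by (simp add: mult_ac)
  qed
  have Y: "l * measure \<nu> (Y i) \<le> 32768 * (A * U * H) * (1/4) ^ i" for i
    unfolding Y_def f_def H_def
    using small_average_bound[OF l P J(1)[of "m + i"], of i] by (auto simp: J_def mult_ac)

  have sets: "Big \<in> sets \<nu>" "X \<in> sets \<nu>" "Y i \<in> sets \<nu>" for i
  proof -
    show "Big \<in> sets \<nu>" unfolding Big_def using finite_I T_sets' by (intro sets.finite_Union) auto
    have [measurable]: "(\<lambda>z. \<Sum>p\<in>(SIGMA k:{..<m}. J k). avg (snd p) * indicator (T (snd p)) z :: real)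
        \<in> borel_measurable \<nu>"
      using J T_sets' by (intro borel_measurable_sum) (auto simp: subset_iff)
    show "X \<in> sets \<nu>" unfolding X_def by measurable
    show "Y i \<in> sets \<nu>" unfolding Y_def space_eq(1)[symmetric] by measurable
  qed
  have "measure \<nu> {z \<in> space \<mu>. l < (\<Sum>i\<in>I. avg i * indicator (T i) z)}
      \<le> measure \<nu> (Big \<union> X \<union> (\<Union>i<n. Y i))"
    using cover sets by (intro nu.finite_measure_mono) auto
  also have "\<dots> \<le> measure \<nu> (Big \<union> X) + measure \<nu> (\<Union>i<n. Y i)"
    using sets by (intro measure_Un_le) auto
  also have "\<dots> \<le> (measure \<nu> Big + measure \<nu> X) + (\<Sum>i<n. measure \<nu> (Y i))"
    using sets by (intro add_mono measure_Un_le measure_UNION_le) auto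
  finally have "l * measure \<nu> {z \<in> space \<mu>. l < (\<Sum>i\<in>I. avg i * indicator (T i) z)}
      \<le> l * ((measure \<nu> Big + measure \<nu> X) + (\<Sum>i<n. measure \<nu> (Y i)))"
    using l by (intro mult_left_mono) auto
  also have "\<dots> = l * measure \<nu> Big + l * measure \<nu> X + (\<Sum>i<n. l * measure \<nu> (Y i))"
    by (simp add: distrib_left sum_distrib_left)
  also have "\<dots> \<le> U * H + 128 * real m * (A * U * H) + (\<Sum>i<n. 32768 * (A * U * H) * (1/4) ^ i)"
    by (intro add_mono sum_mono Big X Y)
  also have "(\<Sum>i<n. 32768 * (A * U * H) * (1/4) ^ i) = 32768 * (A * U * H) * (\<Sum>i<n. (1/4) ^ i)"
    by (simp add: sum_distrib_left)
  also have "\<dots> \<le> 32768 * (A * U * H) * 2"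
  proof (intro mult_left_mono)
    show "(\<Sum>i<n. (1/4::real) ^ i) \<le> 2"
      by (subst sum_gp_strict) (auto simp: field_simps)
  qed (use H in auto)
  finally show ?thesis by (simp add: H_def algebra_simps)
qed

end

section \<open>The Hermitian pairing and the normalized volume\<close>

lemma herm_add_right: "herm z (v + w) = herm z v + herm z w"
  by (simp add: herm_def algebra_simps sum.distrib)

lemma herm_scale_left: "herm (c *\<^sub>R z) w = c *\<^sub>R herm z w"
  by (simp add: herm_def scaleR_sum_right)

lemma herm_mult_right: "herm z (c *s w) = cnj c * herm z w"
  by (simp add: herm_def sum_distrib_left mult_ac)

lemma herm_zero_left [simp]: "herm 0 w = 0"
  by (simp add: herm_def)

lemma herm_self: "herm z z = of_real ((norm z)\<^sup>2)"
  by (simp add: herm_def norm_vec_def L2_set_def sum_nonneg complex_norm_square[symmetric])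

lemma norm_scale_vec: "norm (c *s (z :: complex^'n::finite)) = norm c * norm z"
  by (simp add: norm_vec_def norm_mult L2_set_right_distrib)

lemma Re_herm: "Re (herm z w) = inner z w"
  by (simp add: herm_def inner_vec_def inner_complex_def)

lemma norm_herm_le: "norm (herm z w) \<le> norm z * norm w"
proof -
  have "norm (herm z w) \<le> (\<Sum>j\<in>UNIV. \<bar>norm (z $ j)\<bar> * \<bar>norm (w $ j)\<bar>)"
    unfolding herm_def by (intro order_trans[OF norm_sum] sum_mono) (simp add: norm_mult)
  also have "\<dots> \<le> norm z * norm w"
    unfolding norm_vec_def by (rule L2_set_mult_ineq)
  finally show ?thesis .
qed

lemma continuous_herm [continuous_intros]:
  "continuous_on X f \<Longrightarrow> continuous_on X g \<Longrightarrow> continuous_on X (\<lambda>x. herm (f x) (g x))"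
  unfolding herm_def by (intro continuous_intros)

lemma one_minus_norm_le:
  assumes "norm z < 1" "norm w < 1"
  shows "1 - norm z \<le> norm (1 - herm z w)"
proof -
  have "norm (herm z w) \<le> norm z * 1"
    by (rule order_trans[OF norm_herm_le]) (use assms in \<open>intro mult_left_mono, auto\<close>)
  moreover have "norm (1::complex) - norm (herm z w) \<le> norm (1 - herm z w)" by (rule norm_triangle_ineq2)
  ultimately show ?thesis by simp
qed

lemma space_ball_vol: "space ball_vol = ball 0 1"
  by (simp add: ball_vol_def)

lemma sets_ball_vol: "sets ball_vol = sets (lebesgue_on (ball 0 1))"
  by (simp add: ball_vol_def)

lemma sets_ball_vol_iff:
  "A \<in> sets ball_vol \<longleftrightarrow> A \<subseteq> ball 0 1 \<and> A \<in> sets lebesgue"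
  by (auto simp: sets_ball_vol sets_restrict_space_iff)

lemma borel_set_ball_vol: "A \<in> sets borel \<Longrightarrow> A \<subseteq> ball 0 1 \<Longrightarrow> A \<in> sets ball_vol"
  by (simp add: sets_ball_vol_iff)

lemma emeasure_unit_ball: "0 < emeasure lebesgue (ball 0 1 :: 'a::euclidean_space set)"
    "emeasure lebesgue (ball 0 1 :: 'a::euclidean_space set) < \<infinity>"
  using emeasure_lborel_ball_finite[of "0::'a" 1]
    open_not_negligible[of "ball 0 1 :: 'a set"]
  by (auto simp: negligible_iff_emeasure0 zero_less_iff_neq_zero)

lemma emeasure_lebesgue_on_ball:
  "emeasure (lebesgue_on (ball 0 1)) (ball 0 1 :: 'a::euclidean_space set)
     = emeasure lebesgue (ball 0 1 :: 'a set)"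
  by (subst emeasure_restrict_space) auto

interpretation ball_vol: prob_space "ball_vol :: (complex^'n::finite) measure"
  unfolding ball_vol_def using emeasure_unit_ball[where 'a="complex^'n"]
  by (intro prob_space_uniform_measure) (auto simp: emeasure_lebesgue_on_ball)

lemma measure_ball_vol:
  fixes A :: "(complex^'n::finite) set"
  assumes "A \<in> sets ball_vol"
  shows "measure ball_vol A = measure lebesgue A / measure lebesgue (ball 0 1 :: (complex^'n) set)"
proof -
  have A: "A \<subseteq> ball 0 1" "A \<in> sets lebesgue" using assms by (auto simp: sets_ball_vol_iff)
  then have *: "A \<in> sets (lebesgue_on (ball 0 1))" by (auto simp: sets_restrict_space_iff)
  have "measure ball_vol A = measure (lebesgue_on (ball 0 1)) (ball 0 1 \<inter> A)
      / measure (lebesgue_on (ball 0 1)) (ball 0 1 :: (complex^'n) set)"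
    unfolding ball_vol_def using * emeasure_unit_ball[where 'a="complex^'n"]
    by (intro measure_uniform_measure) (auto simp: emeasure_lebesgue_on_ball)
  then show ?thesis using A by (simp add: measure_restrict_space Int_absorb1)
qed

section \<open>Carleson tents\<close>

lemma carleson_tent_subset: "carleson_tent z \<subseteq> ball 0 1"
  by (auto simp: carleson_tent_def)

lemma carleson_tent_borel: "carleson_tent z \<in> sets borel"
proof (cases "z = 0")
  case False
  have [measurable]: "(\<lambda>w. herm (z /\<^sub>R norm z) w) \<in> borel_measurable borel"
    by (intro borel_measurable_continuous_onI continuous_intros)
  have "carleson_tent z = ball 0 1 \<inter> {w \<in> space borel. norm (1 - herm (z /\<^sub>R norm z) w) < 1 - norm z}"
    using False by (auto simp: carleson_tent_def)
  also have "\<dots> \<in> sets borel" by measurable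
  finally show ?thesis .
qed (simp add: carleson_tent_def)

lemma carleson_tent_sets: "carleson_tent z \<in> sets ball_vol"
  by (intro borel_set_ball_vol carleson_tent_borel carleson_tent_subset)

text \<open>A tent of height \<open>r\<close> has Euclidean diameter at most of order \<open>sqrt r\<close> but is thin, of size \<open>r\<close>, in
  the complex direction of its vertex.  So about \<open>1 / r\<close> disjoint translates in that direction
  fit into a ball of radius of order \<open>sqrt r\<close>, whose volume is of order \<open>r ^ n\<close>; this gives the
  volume \<open>r ^ (n + 1)\<close> for the tent without integrating.\<close>

lemma measure_carleson_tent_le:
  fixes z :: "complex^'n::finite"
  assumes z: "norm z < 1" "z \<noteq> 0"
  shows "measure lebesgue (carleson_tent z)
    \<le> unit_ball_vol (real DIM(complex^'n)) * 100 ^ CARD('n) * (1 - norm z) ^ (CARD('n) + 1)"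
proof -
  define r where "r = 1 - norm z"
  define e where "e = z /\<^sub>R norm z"
  define S where "S = carleson_tent z"
  \<comment> \<open>translates by \<open>2 * r\<close> times Gaussian integers with coordinates below \<open>N\<close>: they are disjoint,
    there are at least \<open>1 / r\<close> of them, and the shifts have length of order \<open>sqrt r\<close>\<close>
  define N where "N = nat \<lceil>1 / sqrt r\<rceil>"
  define v where "v = (\<lambda>p::nat\<times>nat. Complex (2 * r * real (fst p)) (2 * r * real (snd p)) *s e)"
  define G where "G = {..<N} \<times> {..<N}"
  have r: "0 < r" "r \<le> 1" using z by (auto simp: r_def)
  have ne: "norm e = 1" using z by (simp add: e_def)
  have S: "w \<in> S \<Longrightarrow> norm w < 1 \<and> norm (1 - herm e w) < r" for w
    using z by (auto simp: S_def carleson_tent_def e_def r_def)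
  have "1 / sqrt r \<le> real N" unfolding N_def by (rule real_nat_ceiling_ge)
  then have N1: "1 \<le> r * (real N)\<^sup>2"
  proof -
    have "(1 / sqrt r)\<^sup>2 \<le> (real N)\<^sup>2"
      using \<open>1 / sqrt r \<le> real N\<close> r by (intro power_mono) auto
    then show ?thesis using r by (simp add: power_divide field_simps)
  qed
  have "real N \<le> 1 / sqrt r + 1"
    using r by (simp add: N_def)
  then have "r * real N \<le> r * (1 / sqrt r + 1)" using r by (intro mult_left_mono) auto
  also have "\<dots> = sqrt r + r" using r by (simp add: distrib_left real_div_sqrt)
  finally have "r * real N \<le> sqrt r + r" .
  moreover have "r \<le> sqrt r"
    using r by (simp add: real_le_rsqrt power2_eq_square mult_left_le)
  ultimately have rN: "r * real N \<le> 2 * sqrt r" by simp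
  have sub: "(+) (v p) ` S \<subseteq> ball e (10 * sqrt r)" if "p \<in> G" for p
  proof
    fix x assume "x \<in> (+) (v p) ` S"
    then obtain w where w: "w \<in> S" "x = v p + w" by auto
    have "(norm (w - e))\<^sup>2 = (norm w)\<^sup>2 + 1 - 2 * Re (herm e w)"
      using ne by (simp add: Re_herm power2_norm_eq_inner inner_diff inner_commute norm_eq_1)
    also have "\<dots> \<le> 2 * (1 - Re (herm e w))"
      using S[OF w(1)] by (simp add: power_le_one)
    also have "1 - Re (herm e w) \<le> r"
      using S[OF w(1)] complex_Re_le_cmod[of "1 - herm e w"] by simp
    finally have "(norm (w - e))\<^sup>2 \<le> 2 * r" by simp
    then have "norm (w - e) \<le> sqrt (2 * r)" by (rule real_le_rsqrt)
    also have "\<dots> < 2 * sqrt r"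
      using r by (simp add: real_sqrt_mult sqrt2_less_2)
    finally have 1: "norm (w - e) < 2 * sqrt r" .
    have "norm (v p) = norm (Complex (2 * r * real (fst p)) (2 * r * real (snd p)))"
      by (simp add: v_def norm_scale_vec ne)
    also have "\<dots> \<le> \<bar>2 * r * real (fst p)\<bar> + \<bar>2 * r * real (snd p)\<bar>"
      using cmod_le[of "Complex (2 * r * real (fst p)) (2 * r * real (snd p))"] by simp
    also have "\<dots> \<le> 4 * (r * real N)"
    proof -
      have "r * real (fst p) \<le> r * real N" "r * real (snd p) \<le> r * real N"
        using that r by (auto simp: G_def intro!: mult_left_mono)
      moreover have "\<bar>2 * r * real (fst p)\<bar> = 2 * (r * real (fst p))"
        "\<bar>2 * r * real (snd p)\<bar> = 2 * (r * real (snd p))" using r by (simp_all add: abs_mult)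
      ultimately show ?thesis by linarith
    qed
    also have "\<dots> \<le> 8 * sqrt r" using rN by simp
    finally have 2: "norm (v p) \<le> 8 * sqrt r" .
    have "norm (x - e) \<le> norm (v p) + norm (w - e)"
      using norm_triangle_ineq[of "v p" "w - e"] by (simp add: w algebra_simps)
    then have "norm (x - e) < 10 * sqrt r" using 1 2 by linarith
    then show "x \<in> ball e (10 * sqrt r)" by (simp add: dist_norm norm_minus_commute)
  qed
  have disj: "disjoint_family_on (\<lambda>p. (+) (v p) ` S) G"
  proof (unfold disjoint_family_on_def, intro ballI impI, rule ccontr)
    fix p q assume pq: "p \<in> G" "q \<in> G" "p \<noteq> q"
      and ne0: "(+) (v p) ` S \<inter> (+) (v q) ` S \<noteq> {}"
    then obtain a b where ab: "a \<in> S" "b \<in> S" "v p + a = v q + b" by auto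
    let ?d = "Complex (real (fst q) - real (fst p)) (real (snd q) - real (snd p))"
    have "herm e (v p) + herm e a = herm e (v q) + herm e b"
      using ab(3) by (simp flip: herm_add_right)
    then have "herm e a - herm e b = cnj (of_real (2 * r) * ?d)"
      by (simp add: v_def herm_mult_right herm_self ne complex_eq_iff algebra_simps)
    then have "norm (herm e a - herm e b) = 2 * r * norm ?d"
      using r by (simp add: norm_mult del: complex_cnj_mult)
    moreover have "norm (herm e a - herm e b) < 2 * r"
      using S[OF ab(1)] S[OF ab(2)] norm_triangle_ineq4[of "1 - herm e b" "1 - herm e a"] by simp
    ultimately have d: "norm ?d < 1" using r by simp
    have "\<bar>real (fst q) - real (fst p)\<bar> < 1" "\<bar>real (snd q) - real (snd p)\<bar> < 1"
      using abs_Re_le_cmod[of ?d] abs_Im_le_cmod[of ?d] d by simp_all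
    then have "fst p = fst q" "snd p = snd q" by linarith+
    then show False using pq by (simp add: prod_eq_iff)
  qed
  have Sm: "S \<in> lmeasurable"
    using carleson_tent_borel[of z] carleson_tent_subset[of z]
    by (intro bounded_set_imp_lmeasurable) (auto simp: S_def intro: bounded_subset[OF bounded_ball])
  have Tm: "(+) (v p) ` S \<in> lmeasurable" for p
    using Sm by (rule measurable_translation)
  have "(real N)\<^sup>2 * measure lebesgue S = (\<Sum>p\<in>G. measure lebesgue ((+) (v p) ` S))"
    by (simp add: measure_translation G_def power2_eq_square)
  also have "\<dots> = measure lebesgue (\<Union>p\<in>G. (+) (v p) ` S)"
    using fmeasurableD[OF Tm] fmeasurableD2[OF Tm] disj
    by (intro measure_finite_Union[symmetric]) (auto simp: G_def)
  also have "\<dots> \<le> measure lebesgue (ball e (10 * sqrt r))"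
    using sub fmeasurableD[OF Tm]
    by (intro measure_mono_fmeasurable sets.finite_UN) (auto simp: G_def)
  also have "\<dots> = unit_ball_vol (real DIM(complex^'n)) * (10 * sqrt r) ^ DIM(complex^'n)"
    using content_ball[of "10 * sqrt r" e] r by simp
  also have "(10 * sqrt r) ^ DIM(complex^'n) = 100 ^ CARD('n) * r ^ CARD('n)"
    using r by (simp add: power_mult_distrib mult.commute[of "CARD('n)"] power_mult)
  finally have "r * ((real N)\<^sup>2 * measure lebesgue S)
      \<le> r * (unit_ball_vol (real DIM(complex^'n)) * (100 ^ CARD('n) * r ^ CARD('n)))"
    using r by (intro mult_left_mono) auto
  moreover have "1 * measure lebesgue S \<le> (r * (real N)\<^sup>2) * measure lebesgue S"
    by (intro mult_right_mono N1) auto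
  ultimately show ?thesis unfolding S_def[symmetric] r_def[symmetric] by (simp add: mult_ac)
qed

text \<open>The vertex is taken in the direction \<open>e\<close> of \<open>z\<close>: then \<open>herm e z = norm z\<close>, and passing from
  \<open>herm z w\<close> to \<open>herm e w\<close> costs at most \<open>1 - norm z\<close>, which \<open>norm (1 - herm z w)\<close> dominates.\<close>

lemma common_carleson_tent:
  fixes z w :: "complex^'n::finite"
  assumes z: "norm z < 1" and w: "norm w < 1"
  obtains \<zeta> where "norm \<zeta> < 1" "z \<in> carleson_tent \<zeta>" "w \<in> carleson_tent \<zeta>"
    "1 - norm \<zeta> \<le> 3 * norm (1 - herm z w)"
proof -
  let ?D = "norm (1 - herm z w)"
  have D: "1 - norm z \<le> ?D" by (rule one_minus_norm_le[OF z w])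
  show thesis
  proof (cases "3 * ?D \<ge> 1")
    case True
    then show thesis using z w by (intro that[of 0]) (auto simp: carleson_tent_def)
  next
    case False
    have z0: "z \<noteq> 0" using False by auto
    have Dpos: "0 < ?D" using D z by linarith
    define e where "e = z /\<^sub>R norm z"
    have ne: "norm e = 1" using z0 by (simp add: e_def)
    define \<zeta> where "\<zeta> = (1 - 3 * ?D) *\<^sub>R e"
    have n\<zeta>: "norm \<zeta> = 1 - 3 * ?D" using False ne by (simp add: \<zeta>_def)
    then have "\<zeta> \<noteq> 0" using False by auto
    have dir: "\<zeta> /\<^sub>R norm \<zeta> = e"
      using False unfolding n\<zeta> by (simp add: \<zeta>_def)
    have "herm e z = inverse (norm z) *\<^sub>R of_real ((norm z)\<^sup>2)"
      by (simp only: e_def herm_scale_left herm_self)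
    also have "\<dots> = of_real (norm z)"
      using z0 by (simp add: power2_eq_square scaleR_conv_of_real)
    finally have "herm e z = of_real (norm z)" .
    then have "norm (1 - herm e z) = 1 - norm z"
      using z by (metis abs_of_pos diff_gt_0_iff_gt norm_of_real of_real_1 of_real_diff)
    then have 1: "norm (1 - herm e z) < 3 * ?D" using D Dpos by linarith
    have "herm z w - herm e w = - ((1 - norm z) *\<^sub>R herm e w)"
      using z0 by (simp add: e_def herm_scale_left algebra_simps)
    then have "norm (herm z w - herm e w) = (1 - norm z) * norm (herm e w)"
      using z by simp
    also have "\<dots> \<le> ?D * 1"
      using D z w norm_herm_le[of e w] ne by (intro mult_mono) auto
    finally have "norm (1 - herm e w) \<le> 2 * ?D"
      using norm_triangle_ineq[of "1 - herm z w" "herm z w - herm e w"] by simp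
    then have 2: "norm (1 - herm e w) < 3 * ?D" using Dpos by linarith
    show thesis
    proof (rule that[of \<zeta>])
      show "z \<in> carleson_tent \<zeta>" "w \<in> carleson_tent \<zeta>"
        using 1 2 z w \<open>\<zeta> \<noteq> 0\<close> unfolding carleson_tent_def dir by (auto simp: n\<zeta>)
    qed (use n\<zeta> Dpos in auto)
  qed
qed

section \<open>Kubes and dyadic tents\<close>

lemma bergman_dist_zero: "bergman_dist 0 z = ln ((1 + norm z) / (1 - norm z)) / 2"
  by (simp add: bergman_dist_def norm_ball_involution_0_left)

lemma radial_proj_measurable [measurable]:
  "(radial_proj s :: complex^'n::finite \<Rightarrow> _) \<in> borel_measurable borel"
  unfolding radial_proj_def[abs_def] by measurable

lemma bergman_dist_zero_measurable [measurable]: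
  "(bergman_dist 0 :: complex^'n::finite \<Rightarrow> real) \<in> borel_measurable borel"
  unfolding bergman_dist_zero[abs_def] by measurable

lemma kube_subset: "kube \<theta> S K \<subseteq> ball 0 1"
  by (auto simp: kube_def split: prod.splits)

lemma kube_borel:
  assumes S: "is_dyadic_structure \<theta> \<rho> C\<^sub>0 S" and K: "K \<in> kube_ids S"
  shows "kube \<theta> S K \<in> sets borel"
proof (cases K)
  case (Pair k j)
  show ?thesis
  proof (cases "k = 0")
    case True
    have "kube \<theta> S K = ball 0 1 \<inter> {z \<in> space borel. bergman_dist 0 z \<le> \<theta>}"
      using True Pair by (auto simp: kube_def)
    also have "\<dots> \<in> sets borel" by measurable
    finally show ?thesis .
  next
    case False
    then have [measurable]: "cell S k j \<in> sets borel"
      using S K Pair by (auto simp: is_dyadic_structure_def kube_ids_def)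
    have "kube \<theta> S K = ball 0 1 \<inter> {z \<in> space borel. real k * \<theta> < bergman_dist 0 z
        \<and> bergman_dist 0 z \<le> (real k + 1) * \<theta> \<and> radial_proj (real k * \<theta>) z \<in> cell S k j}"
      using False Pair by (auto simp: kube_def)
    also have "\<dots> \<in> sets borel" by measurable
    finally show ?thesis .
  qed
qed

lemma kubes_disjoint:
  assumes S: "is_dyadic_structure \<theta> \<rho> C\<^sub>0 S" and \<theta>: "0 < \<theta>"
  shows "disjoint_family_on (kube \<theta> S) (kube_ids S)"
proof (unfold disjoint_family_on_def, intro ballI impI, rule ccontr)
  fix K L assume K: "K \<in> kube_ids S" and L: "L \<in> kube_ids S" and ne: "K \<noteq> L"
    and "kube \<theta> S K \<inter> kube \<theta> S L \<noteq> {}"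
  then obtain z where z: "z \<in> kube \<theta> S K" "z \<in> kube \<theta> S L" by auto
  have shell: "bergman_dist 0 z \<le> (real (fst J) + 1) * \<theta>"
      "fst J \<noteq> 0 \<Longrightarrow> real (fst J) * \<theta> < bergman_dist 0 z" if "z \<in> kube \<theta> S J" for J
    using that by (auto simp: kube_def split: prod.splits if_splits)
  have le: "fst J \<le> fst J'" if "z \<in> kube \<theta> S J" "z \<in> kube \<theta> S J'" for J J'
  proof (rule ccontr)
    assume "\<not> fst J \<le> fst J'"
    then have "(real (fst J') + 1) * \<theta> \<le> real (fst J) * \<theta>"
      using \<theta> by (intro mult_right_mono) auto
    with shell(1)[OF that(2)] shell(2)[OF that(1)] \<open>\<not> fst J \<le> fst J'\<close> show False by simp
  qed
  have eq: "fst K = fst L" using le[OF z] le[OF z(2) z(1)] by simp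
  show False
  proof (cases "fst K = 0")
    case True
    then show False using K L ne eq by (auto simp: kube_ids_def)
  next
    case False
    then have "radial_proj (real (fst K) * \<theta>) z \<in> cell S (fst K) (snd K)"
      "radial_proj (real (fst K) * \<theta>) z \<in> cell S (fst K) (snd L)"
      using z eq by (auto simp: kube_def split: prod.splits)
    moreover have "disjoint_family_on (cell S (fst K)) {1..num S (fst K)}"
      using S False by (auto simp: is_dyadic_structure_def)
    moreover have "snd K \<in> {1..num S (fst K)}" "snd L \<in> {1..num S (fst K)}"
      using K L False eq by (auto simp: kube_ids_def)
    moreover have "snd K \<noteq> snd L" using ne eq by (auto simp: prod_eq_iff)
    ultimately show False by (meson disjoint_family_onD disjoint_iff)
  qed
qed

lemma tent_subset: "tent \<theta> S K \<subseteq> ball 0 1"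
  unfolding tent_def using kube_subset by blast

lemma kube_subset_tent: "kube \<theta> S K \<subseteq> tent \<theta> S K"
  by (simp add: tent_def)

lemma tent_borel:
  assumes S: "is_dyadic_structure \<theta> \<rho> C\<^sub>0 S" and K: "K \<in> kube_ids S"
  shows "tent \<theta> S K \<in> sets borel"
  unfolding tent_def
proof (intro sets.Un sets.countable_UN' kube_borel[OF S])
  show "countable {K'. kube_descendant \<theta> S K' K}" by (rule countableI_type)
qed (use K in \<open>auto simp: kube_descendant_def intro: kube_borel[OF S]\<close>)

lemma norm_kube_center_less: "norm (kube_center \<theta> S K) < 1"
proof -
  have "norm (radial_proj s z) < 1" for s :: real and z :: "complex^'n::finite"
    using tanh_real_lt_1[of "\<bar>s\<bar>"] by (auto simp: radial_proj_def tanh_real_abs)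
  then show ?thesis by (auto simp: kube_center_def split: prod.splits)
qed

text \<open>A dyadic system seen as a finite collection of laminar families of measurable sets that
  cover the Carleson tents efficiently.\<close>

locale dyadic_tents =
  fixes \<SS> :: "('n::finite) dyadic_structure set" and \<theta> A :: real
  assumes finite_structures: "finite \<SS>"
    and A_ge_1: "1 \<le> A"
    and tent_sets: "S \<in> \<SS> \<Longrightarrow> K \<in> kube_ids S \<Longrightarrow> tent \<theta> S K \<in> sets ball_vol"
    and kube_sets: "S \<in> \<SS> \<Longrightarrow> K \<in> kube_ids S \<Longrightarrow> kube \<theta> S K \<in> sets ball_vol"
    and kube_disjoint: "S \<in> \<SS> \<Longrightarrow> disjoint_family_on (kube \<theta> S) (kube_ids S)"
    and tents_laminar: "S \<in> \<SS> \<Longrightarrow> laminar (tent \<theta> S ` kube_ids S)"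
    and tent_pos: "S \<in> \<SS> \<Longrightarrow> K \<in> kube_ids S \<Longrightarrow> 0 < measure ball_vol (tent \<theta> S K)"
    and tent_le_kube: "S \<in> \<SS> \<Longrightarrow> K \<in> kube_ids S \<Longrightarrow>
        measure ball_vol (tent \<theta> S K) \<le> A * measure ball_vol (kube \<theta> S K)"
    and carleson_tent_covered: "norm \<zeta> < 1 \<Longrightarrow> \<exists>S\<in>\<SS>. \<exists>K\<in>kube_ids S.
        carleson_tent \<zeta> \<subseteq> tent \<theta> S K \<and>
        measure ball_vol (tent \<theta> S K) \<le> A * measure ball_vol (carleson_tent \<zeta>)"

lemma dyadic_system_tents:
  fixes \<SS> :: "('n::finite) dyadic_structure set"
  assumes "dyadic_system \<theta> \<rho> C\<^sub>0 \<SS>"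
  obtains A where "dyadic_tents \<SS> \<theta> A"
proof -
  have \<theta>: "0 < \<theta>" and fin: "finite \<SS>"
    and S: "\<And>S. S \<in> \<SS> \<Longrightarrow> is_dyadic_structure \<theta> \<rho> C\<^sub>0 S"
    and lam: "\<And>S K K'. S \<in> \<SS> \<Longrightarrow> K \<in> kube_ids S \<Longrightarrow> K' \<in> kube_ids S \<Longrightarrow>
        tent \<theta> S K \<inter> tent \<theta> S K' = {} \<or> tent \<theta> S K \<subseteq> tent \<theta> S K' \<or> tent \<theta> S K' \<subseteq> tent \<theta> S K"
    using assms unfolding dyadic_system_def by blast+
  from assms obtain A :: real where
    kubes: "\<forall>(S, K)\<in>all_kubes \<SS>.
           (let m = (1 - (norm (kube_center \<theta> S K))\<^sup>2) ^ (CARD('n) + 1)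
            in measure ball_vol (kube \<theta> S K) \<le> A * measure ball_vol (tent \<theta> S K) \<and>
               measure ball_vol (tent \<theta> S K) \<le> A * measure ball_vol (kube \<theta> S K) \<and>
               measure ball_vol (tent \<theta> S K) \<le> A * m \<and>
               m \<le> A * measure ball_vol (tent \<theta> S K))"
    and cover: "\<forall>z\<in>ball 0 1. \<exists>(S, K)\<in>all_kubes \<SS>. carleson_tent z \<subseteq> tent \<theta> S K \<and>
           measure ball_vol (tent \<theta> S K) \<le> A * measure ball_vol (carleson_tent z)"
    unfolding dyadic_system_def by blast
  show thesis
  proof (rule that[of "max 1 A"], unfold_locales)
    fix S K assume SK: "S \<in> \<SS>" "K \<in> kube_ids S"
    let ?m = "(1 - (norm (kube_center \<theta> S K))\<^sup>2) ^ (CARD('n) + 1)"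
    have k: "measure ball_vol (tent \<theta> S K) \<le> A * measure ball_vol (kube \<theta> S K)"
      "?m \<le> A * measure ball_vol (tent \<theta> S K)"
      using bspec[OF kubes, of "(S, K)"] SK by (auto simp: all_kubes_def Let_def)
    have "(norm (kube_center \<theta> S K))\<^sup>2 < 1"
      using norm_kube_center_less[of \<theta> S K] by (simp add: power_less_one_iff abs_square_less_1)
    then have "0 < ?m" by (intro zero_less_power) simp
    with k(2) have "A * measure ball_vol (tent \<theta> S K) \<noteq> 0" by linarith
    then show "0 < measure ball_vol (tent \<theta> S K)"
      using measure_nonneg[of ball_vol "tent \<theta> S K"] by (auto simp: less_le)
    show "tent \<theta> S K \<in> sets ball_vol" "kube \<theta> S K \<in> sets ball_vol"
      by (rule borel_set_ball_vol[OF tent_borel[OF S[OF SK(1)] SK(2)] tent_subset]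
          borel_set_ball_vol[OF kube_borel[OF S[OF SK(1)] SK(2)] kube_subset])+
    show "measure ball_vol (tent \<theta> S K) \<le> max 1 A * measure ball_vol (kube \<theta> S K)"
      by (rule order_trans[OF k(1)]) (intro mult_right_mono, auto)
  next
    fix S assume "S \<in> \<SS>"
    then show "disjoint_family_on (kube \<theta> S) (kube_ids S)" "laminar (tent \<theta> S ` kube_ids S)"
      using kubes_disjoint[OF S \<theta>] lam by (auto simp: laminar_def)
  next
    fix \<zeta> :: "complex^'n" assume "norm \<zeta> < 1"
    then have "\<exists>(S, K)\<in>all_kubes \<SS>. carleson_tent \<zeta> \<subseteq> tent \<theta> S K \<and>
           measure ball_vol (tent \<theta> S K) \<le> A * measure ball_vol (carleson_tent \<zeta>)"
      using cover by simp
    moreover have "A * measure ball_vol (carleson_tent \<zeta>) \<le> max 1 A * measure ball_vol (carleson_tent \<zeta>)"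
      by (intro mult_right_mono) auto
    ultimately show "\<exists>S\<in>\<SS>. \<exists>K\<in>kube_ids S. carleson_tent \<zeta> \<subseteq> tent \<theta> S K \<and>
        measure ball_vol (tent \<theta> S K) \<le> max 1 A * measure ball_vol (carleson_tent \<zeta>)"
      unfolding all_kubes_def by fastforce
  qed (use fin in auto)
qed

context dyadic_tents
begin

text \<open>Both points lie in a Carleson tent of height comparable to \<open>norm (1 - herm z w)\<close>; the dyadic
  tent that covers it has volume at most comparable to the power of this height in the kernel.\<close>

lemma kernel_le_tent:
  obtains c where "0 < c" "\<And>z w :: complex^'n. norm z < 1 \<Longrightarrow> norm w < 1 \<Longrightarrow>
    \<exists>S\<in>\<SS>. \<exists>K\<in>kube_ids S. z \<in> tent \<theta> S K \<and> w \<in> tent \<theta> S K \<and>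
      1 / norm (1 - herm z w) ^ (CARD('n) + 1) \<le> c / measure ball_vol (tent \<theta> S K)"
proof -
  define b where "b = max 1 (unit_ball_vol (real DIM(complex^'n)) * 100 ^ CARD('n)
      / measure lebesgue (ball 0 1 :: (complex^'n) set))"
  have vol: "measure ball_vol (carleson_tent \<zeta>) \<le> b * (1 - norm \<zeta>) ^ (CARD('n) + 1)"
    if "norm \<zeta> < 1" for \<zeta> :: "complex^'n"
  proof (cases "\<zeta> = 0")
    case True
    then show ?thesis by (simp add: b_def le_max_iff_disj ball_vol.prob_le_1)
  next
    case False
    have "measure ball_vol (carleson_tent \<zeta>)
        \<le> unit_ball_vol (real DIM(complex^'n)) * 100 ^ CARD('n) * (1 - norm \<zeta>) ^ (CARD('n) + 1)
          / measure lebesgue (ball 0 1 :: (complex^'n) set)"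
      unfolding measure_ball_vol[OF carleson_tent_sets]
      using measure_carleson_tent_le[OF that False] by (intro divide_right_mono) auto
    also have "\<dots> \<le> b * (1 - norm \<zeta>) ^ (CARD('n) + 1)"
      unfolding b_def times_divide_eq_left[symmetric] using that by (intro mult_right_mono) auto
    finally show ?thesis .
  qed
  let ?n = "CARD('n) + 1"
  show thesis
  proof (rule that[of "A * b * 3 ^ ?n"])
    show "0 < A * b * 3 ^ ?n" using A_ge_1 by (simp add: b_def)
    fix z w :: "complex^'n" assume zw: "norm z < 1" "norm w < 1"
    obtain \<zeta> where \<zeta>: "norm \<zeta> < 1" "z \<in> carleson_tent \<zeta>" "w \<in> carleson_tent \<zeta>"
      "1 - norm \<zeta> \<le> 3 * norm (1 - herm z w)" by (rule common_carleson_tent[OF zw])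
    obtain S K where SK: "S \<in> \<SS>" "K \<in> kube_ids S" "carleson_tent \<zeta> \<subseteq> tent \<theta> S K"
        "measure ball_vol (tent \<theta> S K) \<le> A * measure ball_vol (carleson_tent \<zeta>)"
      using carleson_tent_covered[OF \<zeta>(1)] by blast
    have D: "0 < norm (1 - herm z w)" using one_minus_norm_le[OF zw] zw by linarith
    have "measure ball_vol (tent \<theta> S K) \<le> A * (b * (1 - norm \<zeta>) ^ ?n)"
      using SK(4) vol[OF \<zeta>(1)] A_ge_1 by (meson mult_left_mono order_trans zero_le_one)
    also have "\<dots> \<le> A * (b * (3 * norm (1 - herm z w)) ^ ?n)"
      using \<zeta> A_ge_1 by (intro mult_left_mono power_mono) (auto simp: b_def)
    finally have "measure ball_vol (tent \<theta> S K) \<le> A * b * 3 ^ ?n * norm (1 - herm z w) ^ ?n"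
      by (simp only: power_mult_distrib mult.assoc)
    then have "1 / norm (1 - herm z w) ^ ?n \<le> A * b * 3 ^ ?n / measure ball_vol (tent \<theta> S K)"
      using D tent_pos[OF SK(1,2)] zero_less_power[OF D, of ?n]
      by (simp only: pos_divide_le_eq pos_le_divide_eq) (simp add: mult_ac pos_divide_le_eq)
    then show "\<exists>S\<in>\<SS>. \<exists>K\<in>kube_ids S. z \<in> tent \<theta> S K \<and> w \<in> tent \<theta> S K \<and>
      1 / norm (1 - herm z w) ^ ?n \<le> A * b * 3 ^ ?n / measure ball_vol (tent \<theta> S K)"
      using SK \<zeta> by blast
  qed
qed

end

section \<open>Testing and packing for the weight\<close>

lemma continuous_measurable_ball_vol:
  fixes g :: "complex^'n::finite \<Rightarrow> 'b::euclidean_space"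
  assumes "continuous_on (ball 0 1) g"
  shows "g \<in> borel_measurable ball_vol"
proof -
  have "g \<in> borel_measurable (lebesgue_on (ball 0 1))"
    using assms by (rule continuous_imp_measurable_on_sets_lebesgue) simp
  then show ?thesis by (simp cong: measurable_cong_sets add: sets_ball_vol)
qed

lemma ennreal_divide_times_cancel:
  fixes x y :: ennreal
  assumes "x \<noteq> 0" "x \<noteq> \<infinity>"
  shows "y / x * x = y"
  using assms by (simp add: ennreal_divide_times ennreal_divide_self less_top)

lemma Linfty_norm_AE:
  assumes "X \<in> sets ball_vol"
  shows "AE z in ball_vol. z \<in> X \<longrightarrow> ennreal (norm (g z)) \<le> Linfty_norm X g"
proof -
  have "AE z in restrict_space ball_vol X. ennreal (norm (g z)) \<le> Linfty_norm X g"
    unfolding Linfty_norm_def by (rule esssup_AE)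
  then show ?thesis using assms by (subst (asm) AE_restrict_space_iff) auto
qed

locale weighted_tents = dyadic_tents \<SS> \<theta> A
  for \<SS> :: "('n::finite) dyadic_structure set" and \<theta> A +
  fixes u :: "complex^'n \<Rightarrow> complex" and \<sigma> :: "complex^'n \<Rightarrow> real"
    and f :: "complex^'n \<Rightarrow> complex"
  assumes u_meas [measurable]: "u \<in> borel_measurable ball_vol"
    and weight: "weight \<sigma>"
    and uB1_finite: "uB1_const \<theta> \<SS> u \<sigma> < \<infinity>"
    and Binf_finite: "Binf_const \<theta> \<SS> \<sigma> < \<infinity>"
    and f_L1: "f \<in> L1_space \<sigma>"
begin

abbreviation "\<mu> \<equiv> ball_vol :: (complex^'n) measure"

definition "\<nu> = density \<mu> (\<lambda>z. ennreal (\<sigma> z))"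
definition "\<gamma> = density \<mu> (\<lambda>z. ennreal (norm (u z * f z)))"
definition "\<eta> = density \<mu> (\<lambda>z. ennreal (norm (f z)) * ennreal (\<sigma> z))"

lemma f_meas [measurable]: "f \<in> borel_measurable \<mu>"
  using f_L1 by (simp add: L1_space_def)

lemma sigma_meas [measurable]: "\<sigma> \<in> borel_measurable \<mu>"
  using weight by (simp add: weight_def)

lemma sigma_pos: "AE z in \<mu>. 0 < \<sigma> z"
  using weight by (simp add: weight_def)

lemma sets_density_measures [simp]:
  "sets \<nu> = sets \<mu>" "sets \<gamma> = sets \<mu>" "sets \<eta> = sets \<mu>"
  by (simp_all add: \<nu>_def \<gamma>_def \<eta>_def)

lemma space_density_measures [simp]:
  "space \<nu> = ball 0 1" "space \<gamma> = ball 0 1" "space \<eta> = ball 0 1"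
  by (simp_all add: \<nu>_def \<gamma>_def \<eta>_def space_ball_vol)

lemma ball_sets [simp]: "ball 0 1 \<in> sets \<mu>"
  by (simp add: sets_ball_vol_iff)

lemma weight_meas_eq: "F \<in> sets \<mu> \<Longrightarrow> weight_meas \<sigma> F = emeasure \<nu> F"
  by (simp add: weight_meas_def \<nu>_def emeasure_density)

lemma eta_ball: "emeasure \<eta> (ball 0 1) = L1_norm \<sigma> f"
  by (simp add: \<eta>_def emeasure_density L1_norm_def space_ball_vol[symmetric]
      cong: nn_integral_cong)

lemma eta_finite: "finite_measure \<eta>"
  using f_L1 by (intro finite_measureI) (auto simp: eta_ball L1_space_def)

lemma nu_pos:
  assumes "F \<in> sets \<mu>" "0 < measure \<mu> F"
  shows "0 < emeasure \<nu> F"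
proof (rule ccontr)
  assume "\<not> 0 < emeasure \<nu> F"
  then have "(\<integral>\<^sup>+z. ennreal (\<sigma> z) * indicator F z \<partial>\<mu>) = 0"
    using assms by (simp add: \<nu>_def emeasure_density)
  then have "AE z in \<mu>. ennreal (\<sigma> z) * indicator F z = 0"
    using assms by (subst (asm) nn_integral_0_iff_AE) auto
  with sigma_pos have "AE z in \<mu>. z \<notin> F"
    by eventually_elim (auto split: split_indicator_asm)
  then have "F \<in> null_sets \<mu>" using assms by (simp add: AE_iff_null_sets)
  then have "measure \<mu> F = 0" by (rule measure_eq_0_null_sets)
  with assms show False by simp
qed

text \<open>On a tent \<open>|u f| \<le> \<parallel>u\<parallel> |f| \<le> \<parallel>u\<parallel> \<parallel>1/\<sigma>\<parallel> |f| \<sigma>\<close> almost everywhere, with essential suprema over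
  the tent; multiplied by the average of \<open>\<sigma>\<close>, the constant becomes the quantity in the \<open>uB\<^sub>1\<close>
  condition.\<close>

lemma testing_condition:
  assumes S: "S \<in> \<SS>" and K: "K \<in> kube_ids S" and F: "F \<in> sets \<mu>" "F \<subseteq> tent \<theta> S K"
  shows "emeasure \<gamma> F * emeasure \<nu> (tent \<theta> S K)
    \<le> uB1_const \<theta> \<SS> u \<sigma> * emeasure \<mu> (tent \<theta> S K) * emeasure \<eta> F"
proof -
  let ?T = "tent \<theta> S K"
  define a where "a = Linfty_norm ?T u"
  define b where "b = Linfty_norm ?T (\<lambda>z. inverse (\<sigma> z))"
  have T: "?T \<in> sets \<mu>" "0 < measure \<mu> ?T" using tent_sets[OF S K] tent_pos[OF S K] .
  have eT: "emeasure \<mu> ?T \<noteq> 0" "emeasure \<mu> ?T \<noteq> \<infinity>"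
    using T by (auto simp: measure_def)
  have nu_T: "emeasure \<nu> ?T = average ?T (\<lambda>z. ennreal (\<sigma> z)) * emeasure \<mu> ?T"
    using T unfolding average_def ennreal_divide_times_cancel[OF eT]
    by (simp add: \<nu>_def emeasure_density)
  have "AE z in \<mu>. ennreal (norm (u z * f z)) * indicator F z
      \<le> (a * b) * (ennreal (norm (f z)) * ennreal (\<sigma> z) * indicator F z)"
    using sigma_pos Linfty_norm_AE[OF T(1), of u] Linfty_norm_AE[OF T(1), of "\<lambda>z. inverse (\<sigma> z)"]
  proof eventually_elim
    case (elim z)
    show ?case
    proof (cases "z \<in> F")
      case True
      with F have zT: "z \<in> ?T" by auto
      have "1 = ennreal (norm (inverse (\<sigma> z))) * ennreal (\<sigma> z)"
        using elim(1) by (simp add: ennreal_mult[symmetric])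
      also have "\<dots> \<le> b * ennreal (\<sigma> z)"
        using elim(3) zT by (intro mult_right_mono) (auto simp: b_def)
      finally have 1: "ennreal (norm (f z)) * 1 \<le> ennreal (norm (f z)) * (b * ennreal (\<sigma> z))"
        by (intro mult_left_mono) auto
      have "ennreal (norm (u z * f z)) = ennreal (norm (u z)) * ennreal (norm (f z))"
        by (simp add: norm_mult ennreal_mult)
      also have "\<dots> \<le> a * (ennreal (norm (f z)) * (b * ennreal (\<sigma> z)))"
        using elim(2) zT 1 by (intro mult_mono) (auto simp: a_def)
      finally show ?thesis using True by (simp add: mult_ac)
    qed simp
  qed
  then have "emeasure \<gamma> F \<le> (\<integral>\<^sup>+z. (a * b) * (ennreal (norm (f z)) * ennreal (\<sigma> z) * indicator F z) \<partial>\<mu>)"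
    using F by (simp add: \<gamma>_def emeasure_density nn_integral_mono_AE)
  also have "\<dots> = a * b * emeasure \<eta> F"
    using F by (subst nn_integral_cmult) (auto simp: \<eta>_def emeasure_density)
  finally have "emeasure \<gamma> F * emeasure \<nu> ?T \<le> a * b * emeasure \<eta> F * emeasure \<nu> ?T"
    by (rule mult_right_mono) simp
  also have "a * b * emeasure \<eta> F * emeasure \<nu> ?T
      = (a * average ?T (\<lambda>z. ennreal (\<sigma> z)) * b) * (emeasure \<mu> ?T * emeasure \<eta> F)"
    unfolding nu_T by (simp add: mult_ac)
  also have "\<dots> \<le> uB1_const \<theta> \<SS> u \<sigma> * (emeasure \<mu> ?T * emeasure \<eta> F)"
  proof (rule mult_right_mono)
    have "(S, K) \<in> all_kubes \<SS>" using S K by (simp add: all_kubes_def)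
    then show "a * average ?T (\<lambda>z. ennreal (\<sigma> z)) * b \<le> uB1_const \<theta> \<SS> u \<sigma>"
      unfolding uB1_const_def a_def b_def by (rule SUP_upper2) simp
  qed simp
  finally show ?thesis by (simp add: mult.assoc)
qed

text \<open>On the kube of a subtent the maximal function is at least the average over that subtent, and
  the kubes are disjoint and fill a fixed proportion of their tents.  So the integral in the
  \<open>B\<^sub>\<infinity>\<close> condition dominates the sum of the weights of the subtents.\<close>

lemma packing_condition:
  assumes S: "S \<in> \<SS>" and I: "I \<subseteq> kube_ids S" "finite I" and K: "K \<in> kube_ids S"
    and fin: "emeasure \<nu> (tent \<theta> S K) < \<infinity>"
  shows "(\<Sum>L | L \<in> I \<and> tent \<theta> S L \<subseteq> tent \<theta> S K. emeasure \<nu> (tent \<theta> S L))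
    \<le> ennreal A * Binf_const \<theta> \<SS> \<sigma> * emeasure \<nu> (tent \<theta> S K)"
proof -
  let ?T = "tent \<theta> S"
  let ?J = "{L. L \<in> I \<and> ?T L \<subseteq> ?T K}"
  let ?m = "maximal_fun \<theta> \<SS> (\<lambda>w. \<sigma> w * indicator (?T K) w)"
  define av where "av L = average (?T L) (\<lambda>w. ennreal \<bar>\<sigma> w * indicator (?T K) w\<bar>)" for L
  have T: "?T L \<in> sets \<mu>" "0 < measure \<mu> (?T L)" if "L \<in> kube_ids S" for L
    using tent_sets[OF S that] tent_pos[OF S that] .
  have finJ: "finite ?J" using I by auto
  have av_le: "av L \<le> ?m z" if "L \<in> kube_ids S" "z \<in> ?T L" for L z
  proof -
    have "(S, L) \<in> all_kubes \<SS>" using S that by (simp add: all_kubes_def)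
    then show ?thesis unfolding maximal_fun_def av_def
      by (rule SUP_upper2) (use that in simp)
  qed
  have "(\<Sum>L\<in>?J. emeasure \<nu> (?T L)) \<le> (\<Sum>L\<in>?J. ennreal A * (av L * emeasure \<mu> (kube \<theta> S L)))"
  proof (rule sum_mono)
    fix L assume "L \<in> ?J"
    then have L: "L \<in> kube_ids S" "?T L \<subseteq> ?T K" using I by auto
    have eT: "emeasure \<mu> (?T L) \<noteq> 0" "emeasure \<mu> (?T L) \<noteq> \<infinity>"
      using T[OF L(1)] by (auto simp: measure_def)
    have "emeasure \<nu> (?T L) = (\<integral>\<^sup>+z. ennreal (\<sigma> z) * indicator (?T L) z \<partial>\<mu>)"
      using T[OF L(1)] by (simp add: \<nu>_def emeasure_density)
    also have "\<dots> \<le> (\<integral>\<^sup>+z. ennreal \<bar>\<sigma> z * indicator (?T K) z\<bar> * indicator (?T L) z \<partial>\<mu>)"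
      using L(2) by (intro nn_integral_mono) (auto split: split_indicator intro: ennreal_leI)
    also have "\<dots> = av L * emeasure \<mu> (?T L)"
      unfolding av_def average_def ennreal_divide_times_cancel[OF eT] ..
    also have "\<dots> \<le> av L * (ennreal A * emeasure \<mu> (kube \<theta> S L))"
    proof (rule mult_left_mono)
      have "ennreal (measure \<mu> (?T L)) \<le> ennreal (A * measure \<mu> (kube \<theta> S L))"
        by (rule ennreal_leI[OF tent_le_kube[OF S L(1)]])
      then show "emeasure \<mu> (?T L) \<le> ennreal A * emeasure \<mu> (kube \<theta> S L)"
        using A_ge_1 by (simp add: ball_vol.emeasure_eq_measure ennreal_mult)
    qed simp
    finally show "emeasure \<nu> (?T L) \<le> ennreal A * (av L * emeasure \<mu> (kube \<theta> S L))"
      by (simp add: mult_ac)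
  qed
  also have "\<dots> = ennreal A * (\<integral>\<^sup>+z. (\<Sum>L\<in>?J. av L * indicator (kube \<theta> S L) z) \<partial>\<mu>)"
  proof -
    have kube: "kube \<theta> S L \<in> sets \<mu>" if "L \<in> ?J" for L using that I by (intro kube_sets[OF S]) auto
    have "(\<integral>\<^sup>+z. (\<Sum>L\<in>?J. av L * indicator (kube \<theta> S L) z) \<partial>\<mu>)
        = (\<Sum>L\<in>?J. \<integral>\<^sup>+z. av L * indicator (kube \<theta> S L) z \<partial>\<mu>)"
      using kube by (intro nn_integral_sum borel_measurable_times borel_measurable_indicator) auto
    also have "\<dots> = (\<Sum>L\<in>?J. av L * emeasure \<mu> (kube \<theta> S L))"
      using kube by (intro sum.cong refl nn_integral_cmult_indicator)
    finally show ?thesis by (simp add: sum_distrib_left)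
  qed
  also have "\<dots> \<le> ennreal A * (\<integral>\<^sup>+z. ?m z * indicator (?T K) z \<partial>\<mu>)"
  proof (intro mult_left_mono nn_integral_mono)
    fix z
    show "(\<Sum>L\<in>?J. av L * indicator (kube \<theta> S L) z) \<le> ?m z * indicator (?T K) z"
    proof (cases "\<exists>L\<in>?J. z \<in> kube \<theta> S L")
      case True
      then obtain L where L: "L \<in> ?J" "z \<in> kube \<theta> S L" by blast
      have "indicator (kube \<theta> S L') z = (0::ennreal)" if "L' \<in> ?J - {L}" for L'
      proof -
        have "kube \<theta> S L \<inter> kube \<theta> S L' = {}"
          using that L I by (intro disjoint_family_onD[OF kube_disjoint[OF S]]) auto
        then show ?thesis using L by (auto simp: indicator_def)
      qed
      then have "(\<Sum>L\<in>?J. av L * indicator (kube \<theta> S L) z) = av L"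
        using L by (subst sum.remove[OF finJ L(1)]) simp
      also have "\<dots> \<le> ?m z" using av_le L I kube_subset_tent[of \<theta> S L] by blast
      also have "\<dots> = ?m z * indicator (?T K) z"
        using L kube_subset_tent[of \<theta> S L] by auto
      finally show ?thesis .
    next
      case False
      then have "(\<Sum>L\<in>?J. av L * indicator (kube \<theta> S L) z) = 0" by (intro sum.neutral) auto
      then show ?thesis by simp
    qed
  qed simp
  also have "(\<integral>\<^sup>+z. ?m z * indicator (?T K) z \<partial>\<mu>) \<le> Binf_const \<theta> \<SS> \<sigma> * emeasure \<nu> (?T K)"
  proof -
    have pos: "0 < emeasure \<nu> (?T K)" by (rule nu_pos[OF T[OF K]])
    have "(S, K) \<in> all_kubes \<SS>" using S K by (simp add: all_kubes_def)
    then have "(\<integral>\<^sup>+z. ?m z * indicator (?T K) z \<partial>\<mu>) / emeasure \<nu> (?T K) \<le> Binf_const \<theta> \<SS> \<sigma>"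
      unfolding Binf_const_def weight_meas_eq[OF T(1)[OF K], symmetric] by (rule SUP_upper2) simp
    then have "(\<integral>\<^sup>+z. ?m z * indicator (?T K) z \<partial>\<mu>) / emeasure \<nu> (?T K) * emeasure \<nu> (?T K)
        \<le> Binf_const \<theta> \<SS> \<sigma> * emeasure \<nu> (?T K)"
      by (rule mult_right_mono) simp
    then show ?thesis using pos fin by (simp add: ennreal_divide_times_cancel)
  qed
  finally show ?thesis by (simp add: mult_left_mono mult.assoc)
qed

text \<open>The unit ball is the Carleson tent over \<open>0\<close>, hence itself a dyadic tent.  Testing on it
  gives the finiteness of \<open>\<gamma>\<close>; it also shows that a weight of infinite total mass forces
  \<open>u f = 0\<close> almost everywhere.\<close>

lemma ball_is_tent:
  obtains S K where "S \<in> \<SS>" "K \<in> kube_ids S" "tent \<theta> S K = ball 0 1"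
  using carleson_tent_covered[of 0] tent_subset by (fastforce simp: carleson_tent_def)

lemma gamma_nu_ball: "emeasure \<gamma> (ball 0 1) * emeasure \<nu> (ball 0 1) < \<infinity>"
proof -
  obtain S K where SK: "S \<in> \<SS>" "K \<in> kube_ids S" "tent \<theta> S K = ball 0 1"
    by (rule ball_is_tent)
  have "emeasure \<gamma> (ball 0 1) * emeasure \<nu> (ball 0 1)
      \<le> uB1_const \<theta> \<SS> u \<sigma> * emeasure \<mu> (ball 0 1) * emeasure \<eta> (ball 0 1)"
    using testing_condition[OF SK(1,2), of "ball 0 1"] SK(3) by simp
  also have "\<dots> < \<infinity>"
    using uB1_finite f_L1
    by (auto simp: eta_ball L1_space_def ball_vol.emeasure_eq_measure ennreal_mult_less_top)
  finally show ?thesis .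
qed

lemma nu_ball_pos: "0 < emeasure \<nu> (ball 0 1)"
proof (rule nu_pos)
  have "measure \<mu> (space \<mu>) = 1" by (rule ball_vol.prob_space)
  then show "0 < measure \<mu> (ball 0 1)" by (simp add: space_ball_vol)
qed simp

lemma gamma_finite: "finite_measure \<gamma>"
  using gamma_nu_ball nu_ball_pos by (intro finite_measureI) (auto simp: ennreal_mult_less_top)

lemma gamma_null:
  assumes "emeasure \<nu> (ball 0 1) = \<infinity>"
  shows "emeasure \<gamma> (ball 0 1) = 0"
  using gamma_nu_ball unfolding assms by (simp add: ennreal_mult_less_top)

definition sparse_const :: real where
  "sparse_const = 1 + 128 * A * (ln A + 2) + 65536 * A"

definition log_factor :: real where
  "log_factor = ln (exp 1 + enn2real (Binf_const \<theta> \<SS> \<sigma>))"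

lemma log_factor_ge_1: "1 \<le> log_factor"
  unfolding log_factor_def by (subst ln_ge_iff) (auto intro: add_pos_nonneg)

definition tent_average :: "'n dyadic_structure \<Rightarrow> nat \<times> nat \<Rightarrow> real" where
  "tent_average S K = measure \<gamma> (tent \<theta> S K) / measure \<mu> (tent \<theta> S K)"

text \<open>The number of classes to be estimated in \<open>L\<^sup>1\<close> is chosen as the least \<open>m\<close> with
  \<open>P \<le> 16 ^ m\<close>, where \<open>P = A * B\<close>; it is bounded by the logarithmic factor up to a constant that
  depends on \<open>A\<close>.\<close>

lemma weak_type_structure:
  assumes S: "S \<in> \<SS>" and I: "I \<subseteq> kube_ids S" "finite I" and l: "0 < l"
    and fin: "emeasure \<nu> (ball 0 1) < \<infinity>"
  shows "l * measure \<nu> {z \<in> ball 0 1. l < (\<Sum>K\<in>I. tent_average S K * indicator (tent \<theta> S K) z)}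
    \<le> sparse_const * log_factor * enn2real (uB1_const \<theta> \<SS> u \<sigma>) * measure \<eta> (ball 0 1)"
proof -
  define B where "B = enn2real (Binf_const \<theta> \<SS> \<sigma>)"
  define U where "U = enn2real (uB1_const \<theta> \<SS> u \<sigma>)"
  have B: "Binf_const \<theta> \<SS> \<sigma> = ennreal B" "0 \<le> B"
    using Binf_finite by (auto simp: B_def ennreal_enn2real_if)
  have U: "uB1_const \<theta> \<SS> u \<sigma> = ennreal U" "0 \<le> U"
    using uB1_finite by (auto simp: U_def ennreal_enn2real_if)
  interpret nu: finite_measure \<nu> using fin by (intro finite_measureI) auto
  interpret gam: finite_measure \<gamma> by (rule gamma_finite)
  interpret eta: finite_measure \<eta> by (rule eta_finite)
  interpret W: weighted_sparse_family \<mu> I "tent \<theta> S" "kube \<theta> S" A \<nu> \<gamma> \<eta> U "A * B"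
  proof
    fix K assume "K \<in> I"
    then have K: "K \<in> kube_ids S" using I by auto
    show "tent \<theta> S K \<in> sets \<mu>" "kube \<theta> S K \<in> sets \<mu>" "0 < measure \<mu> (tent \<theta> S K)"
      "measure \<mu> (tent \<theta> S K) \<le> A * measure \<mu> (kube \<theta> S K)"
      by (rule tent_sets kube_sets tent_pos tent_le_kube; (rule S K))+
    show "kube \<theta> S K \<subseteq> tent \<theta> S K" by (rule kube_subset_tent)
    show "(\<Sum>L | L \<in> I \<and> tent \<theta> S L \<subseteq> tent \<theta> S K. measure \<nu> (tent \<theta> S L))
        \<le> A * B * measure \<nu> (tent \<theta> S K)"
      using packing_condition[OF S I K] nu.emeasure_finite[of "tent \<theta> S K"] A_ge_1 B
      by (simp add: nu.emeasure_eq_measure B ennreal_mult'[symmetric] less_top[symmetric] sum_nonneg)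
    fix F assume "F \<in> sets \<mu>" "F \<subseteq> tent \<theta> S K"
    from testing_condition[OF S K this]
    show "measure \<gamma> F * measure \<nu> (tent \<theta> S K) \<le> U * measure \<mu> (tent \<theta> S K) * measure \<eta> F"
      using U by (simp add: nu.emeasure_eq_measure gam.emeasure_eq_measure eta.emeasure_eq_measure
          ball_vol.emeasure_eq_measure ennreal_mult'[symmetric])
  qed (use I A_ge_1 U disjoint_family_on_mono[OF I(1) kube_disjoint[OF S]]
        laminar_mono[OF tents_laminar[OF S], of "tent \<theta> S ` I"] in
        \<open>auto intro: nu.finite_measure_axioms gam.finite_measure_axioms eta.finite_measure_axioms\<close>)
  define p where "p = log 16 (max 1 (A * B))"
  have p: "0 \<le> p" by (simp add: p_def)
  have "A * B \<le> 16 powr p" by (simp add: p_def)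
  also have "\<dots> \<le> 16 powr real (nat \<lceil>p\<rceil>)" by (intro powr_mono real_nat_ceiling_ge) auto
  also have "\<dots> = 16 ^ nat \<lceil>p\<rceil>" by (simp add: powr_realpow)
  finally have m: "A * B \<le> 16 ^ nat \<lceil>p\<rceil>" .
  have "p \<le> ln (max 1 (A * B))"
  proof -
    have "1 \<le> ln (16::real)" by (subst ln_ge_iff) (auto intro: order_trans[OF exp_le])
    then have "ln (max 1 (A * B)) / ln 16 \<le> ln (max 1 (A * B)) / 1"
      by (intro divide_left_mono) auto
    then show ?thesis by (simp add: p_def log_def)
  qed
  also have "\<dots> \<le> ln (A * (exp 1 + B))"
  proof (subst ln_le_cancel_iff)
    have "1 * 1 \<le> A * (exp 1 + B)"
      using A_ge_1 B exp_ge_add_one_self[of 1] by (intro mult_mono) auto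
    moreover have "A * B \<le> A * (exp 1 + B)" using A_ge_1 by (intro mult_left_mono) auto
    ultimately show "max 1 (A * B) \<le> A * (exp 1 + B)" "0 < A * (exp 1 + B)" by auto
  qed auto
  also have "\<dots> = ln A + log_factor"
  proof -
    have "0 < exp 1 + B" using B by (simp add: add_pos_nonneg)
    then have "ln (A * (exp 1 + B)) = ln A + ln (exp 1 + B)" using A_ge_1 by (intro ln_mult_pos) auto
    then show ?thesis by (simp add: log_factor_def B_def)
  qed
  finally have "real (nat \<lceil>p\<rceil>) \<le> ln A + log_factor + 1" using p by linarith
  also have "\<dots> \<le> (ln A + 2) * log_factor"
  proof -
    have "ln A * 1 \<le> ln A * log_factor" using log_factor_ge_1 A_ge_1 by (intro mult_left_mono) auto
    then show ?thesis using log_factor_ge_1 by (simp add: distrib_right)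
  qed
  finally have "128 * A * real (nat \<lceil>p\<rceil>) \<le> 128 * A * ((ln A + 2) * log_factor)"
    using A_ge_1 by (intro mult_left_mono) auto
  moreover have "(1 + 65536 * A) * 1 \<le> (1 + 65536 * A) * log_factor"
    using A_ge_1 log_factor_ge_1 by (intro mult_left_mono) auto
  ultimately have "1 + 128 * A * real (nat \<lceil>p\<rceil>) + 65536 * A \<le> sparse_const * log_factor"
    by (simp add: sparse_const_def algebra_simps)
  then have "(1 + 128 * A * real (nat \<lceil>p\<rceil>) + 65536 * A) * (U * measure \<eta> (ball 0 1))
      \<le> sparse_const * log_factor * (U * measure \<eta> (ball 0 1))"
    using U by (intro mult_right_mono) auto
  moreover have "W.avg = tent_average S" by (auto simp: W.avg_def tent_average_def)
  ultimately show ?thesis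
    using W.weak_type_sparse_operator[OF l m] by (simp add: space_ball_vol U_def mult.assoc)
qed

text \<open>Finitely many structures are handled together by distributing the level evenly.\<close>

lemma weak_type_structures:
  assumes I: "\<And>S. S \<in> \<SS> \<Longrightarrow> I S \<subseteq> kube_ids S" "\<And>S. S \<in> \<SS> \<Longrightarrow> finite (I S)" and l: "0 < l"
    and fin: "emeasure \<nu> (ball 0 1) < \<infinity>"
  shows "l * measure \<nu> {z \<in> ball 0 1.
      l < (\<Sum>S\<in>\<SS>. \<Sum>K\<in>I S. tent_average S K * indicator (tent \<theta> S K) z)}
    \<le> (card \<SS>)\<^sup>2 * sparse_const * log_factor * enn2real (uB1_const \<theta> \<SS> u \<sigma>) * measure \<eta> (ball 0 1)"
proof -
  define F where "F S z = (\<Sum>K\<in>I S. tent_average S K * indicator (tent \<theta> S K) z :: real)" for S z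
  let ?M = "real (card \<SS>)"
  let ?R = "sparse_const * log_factor * enn2real (uB1_const \<theta> \<SS> u \<sigma>) * measure \<eta> (ball 0 1)"
  interpret nu: finite_measure \<nu> using fin by (intro finite_measureI) auto
  obtain S0 where "S0 \<in> \<SS>" using carleson_tent_covered[of 0] by auto
  then have M: "0 < ?M" using finite_structures by (auto simp: card_gt_0_iff)
  have [measurable]: "F S \<in> borel_measurable \<mu>" if "S \<in> \<SS>" for S
    unfolding F_def using I(1)[OF that] tent_sets[OF that]
    by (intro borel_measurable_sum borel_measurable_times borel_measurable_const
        borel_measurable_indicator) blast
  have sets: "{z \<in> ball 0 1. l / ?M < F S z} \<in> sets \<nu>" if "S \<in> \<SS>" for S
  proof -
    note [measurable] = \<open>S \<in> \<SS> \<Longrightarrow> F S \<in> borel_measurable \<mu>\<close>[OF that]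
    have "{z \<in> space \<mu>. l / ?M < F S z} \<in> sets \<mu>" by measurable
    then show ?thesis by (simp add: space_ball_vol)
  qed
  have "{z \<in> ball 0 1. l < (\<Sum>S\<in>\<SS>. F S z)} \<subseteq> (\<Union>S\<in>\<SS>. {z \<in> ball 0 1. l / ?M < F S z})"
  proof
    fix z assume z: "z \<in> {z \<in> ball 0 1. l < (\<Sum>S\<in>\<SS>. F S z)}"
    have "\<exists>S\<in>\<SS>. l / ?M < F S z"
    proof (rule ccontr)
      assume "\<not> ?thesis"
      then have "(\<Sum>S\<in>\<SS>. F S z) \<le> (\<Sum>S\<in>\<SS>. l / ?M)" by (intro sum_mono) (auto simp: not_less)
      also have "\<dots> = l" using M by simp
      finally show False using z by simp
    qed
    then show "z \<in> (\<Union>S\<in>\<SS>. {z \<in> ball 0 1. l / ?M < F S z})" using z by auto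
  qed
  then have "measure \<nu> {z \<in> ball 0 1. l < (\<Sum>S\<in>\<SS>. F S z)}
      \<le> measure \<nu> (\<Union>S\<in>\<SS>. {z \<in> ball 0 1. l / ?M < F S z})"
    using sets finite_structures by (intro nu.finite_measure_mono sets.finite_UN) auto
  also have "\<dots> \<le> (\<Sum>S\<in>\<SS>. measure \<nu> {z \<in> ball 0 1. l / ?M < F S z})"
    using sets finite_structures by (intro measure_UNION_le) auto
  also have "\<dots> \<le> (\<Sum>S\<in>\<SS>. ?M / l * ?R)"
  proof (rule sum_mono)
    fix S assume S: "S \<in> \<SS>"
    have "l / ?M * measure \<nu> {z \<in> ball 0 1. l / ?M < F S z} \<le> ?R"
      unfolding F_def using l M by (intro weak_type_structure S I fin) auto
    then show "measure \<nu> {z \<in> ball 0 1. l / ?M < F S z} \<le> ?M / l * ?R"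
      using l M by (simp add: field_simps)
  qed
  also have "\<dots> = ?M\<^sup>2 / l * ?R" by (simp add: power2_eq_square)
  finally show ?thesis using l by (simp add: F_def field_simps)
qed

section \<open>The Toeplitz operator\<close>

lemma herm_measurable [measurable]: "herm z \<in> borel_measurable \<mu>"
  by (intro continuous_measurable_ball_vol continuous_intros)

lemma integrand_measurable [measurable]: "toeplitz_integrand u f z \<in> borel_measurable \<mu>"
  unfolding toeplitz_integrand_def[abs_def] by measurable

lemma integrable_uf: "integrable \<mu> (\<lambda>w. norm (u w * f w))"
proof (rule integrableI_bounded)
  have "(\<integral>\<^sup>+w. ennreal (norm (u w * f w)) \<partial>\<mu>) = emeasure \<gamma> (space \<mu>)"
    by (simp add: \<gamma>_def emeasure_density cong: nn_integral_cong)
  also have "\<dots> < \<infinity>"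
    using finite_measure.emeasure_finite[OF gamma_finite, of "space \<mu>"] by (simp add: less_top)
  finally show "(\<integral>\<^sup>+w. ennreal (norm (norm (u w * f w))) \<partial>\<mu>) < \<infinity>" by simp
qed simp

lemma integrand_bound:
  assumes "norm z \<le> r" "r < 1" "norm w < 1"
  shows "norm (toeplitz_integrand u f z w) \<le> norm (u w * f w) / (1 - r) ^ (CARD('n) + 1)"
proof -
  have "1 - r \<le> norm (1 - herm z w)"
    using one_minus_norm_le[of z w] assms by linarith
  then have le: "(1 - r) ^ (CARD('n) + 1) \<le> norm (1 - herm z w) ^ (CARD('n) + 1)"
    using assms by (intro power_mono) auto
  have pos: "0 < (1 - r) ^ (CARD('n) + 1)" using assms by (intro zero_less_power) auto
  show ?thesis
    unfolding toeplitz_integrand_def norm_divide norm_power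
    by (intro divide_left_mono[OF le] mult_pos_pos less_le_trans[OF pos le] pos norm_ge_zero)
qed

lemma integrand_integrable:
  assumes "norm z < 1"
  shows "integrable \<mu> (toeplitz_integrand u f z)"
proof (rule Bochner_Integration.integrable_bound)
  show "integrable \<mu> (\<lambda>w. norm (u w * f w) / (1 - norm z) ^ (CARD('n) + 1))"
    by (intro integrable_divide integrable_uf)
  show "AE w in \<mu>. norm (toeplitz_integrand u f z w)
      \<le> norm (norm (u w * f w) / (1 - norm z) ^ (CARD('n) + 1))"
  proof (rule AE_I2)
    fix w assume "w \<in> space \<mu>"
    then have "norm w < 1" by (simp add: space_ball_vol)
    from integrand_bound[OF order_refl assms this]
    show "norm (toeplitz_integrand u f z w)
      \<le> norm (norm (u w * f w) / (1 - norm z) ^ (CARD('n) + 1))" 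
      by (rule order_trans) (simp only: real_norm_def abs_ge_self)
  qed
qed simp

text \<open>Measurability of \<open>toeplitz u f\<close> comes from continuity; the integrands are dominated on
  each smaller concentric ball.\<close>

lemma toeplitz_continuous: "continuous_on (ball 0 1) (toeplitz u f)"
proof -
  have "continuous_on (ball 0 r) (toeplitz u f)" if r: "r < 1" for r
    unfolding continuous_on_sequentially
  proof (intro allI ballI impI)
    fix x :: "nat \<Rightarrow> complex^'n" and a
    assume a: "a \<in> ball 0 r" and x: "(\<forall>n. x n \<in> ball 0 r) \<and> x \<longlonglongrightarrow> a"
    show "(toeplitz u f \<circ> x) \<longlonglongrightarrow> toeplitz u f a"
      unfolding toeplitz_def[abs_def] o_def
    proof (rule integral_dominated_convergence)
      show "integrable \<mu> (\<lambda>w. norm (u w * f w) / (1 - r) ^ (CARD('n) + 1))"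
        by (intro integrable_divide integrable_uf)
      show "AE w in \<mu>. norm (toeplitz_integrand u f (x i) w)
          \<le> norm (u w * f w) / (1 - r) ^ (CARD('n) + 1)" for i
        using x r by (intro AE_I2 integrand_bound) (auto simp: space_ball_vol less_imp_le)
      show "AE w in \<mu>. (\<lambda>i. toeplitz_integrand u f (x i) w) \<longlonglongrightarrow> toeplitz_integrand u f a w"
      proof (rule AE_I2)
        fix w assume "w \<in> space \<mu>"
        then have "norm w < 1" by (simp add: space_ball_vol)
        then have "1 - herm a w \<noteq> 0"
          using one_minus_norm_le[of a w] a r by auto
        moreover have "(\<lambda>i. herm (x i) w) \<longlonglongrightarrow> herm a w"
          unfolding herm_def using x by (intro tendsto_intros) auto
        ultimately show "(\<lambda>i. toeplitz_integrand u f (x i) w) \<longlonglongrightarrow> toeplitz_integrand u f a w"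
          unfolding toeplitz_integrand_def by (intro tendsto_intros) auto
      qed
    qed auto
  qed
  then have "continuous_on (\<Union>r\<in>{..<1}. ball 0 r) (toeplitz u f)"
    by (intro continuous_on_open_UN) auto
  moreover have "(\<Union>r\<in>{..<1::real}. ball 0 r) = (ball 0 1 :: (complex^'n) set)"
  proof (intro equalityI subsetI)
    fix z :: "complex^'n" assume "z \<in> ball 0 1"
    then show "z \<in> (\<Union>r\<in>{..<1}. ball 0 r)"
      by (intro UN_I[of "(1 + norm z) / 2"]) auto
  qed auto
  ultimately show ?thesis by simp
qed

lemma toeplitz_measurable: "toeplitz u f \<in> borel_measurable \<mu>"
  by (rule continuous_measurable_ball_vol[OF toeplitz_continuous])

text \<open>The kubes of a structure are exhausted by finite sets, to which the estimates for finite
  families apply with constants that do not depend on the truncation.\<close>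

definition kube_ids_upto :: "nat \<Rightarrow> 'n dyadic_structure \<Rightarrow> (nat \<times> nat) set" where
  "kube_ids_upto N S = kube_ids S \<inter> ({..N} \<times> {..N})"

definition sparse_sum :: "nat \<Rightarrow> complex^'n \<Rightarrow> real" where
  "sparse_sum N z
    = (\<Sum>S\<in>\<SS>. \<Sum>K\<in>kube_ids_upto N S. tent_average S K * indicator (tent \<theta> S K) z)"

lemma finite_kube_ids_upto [simp]: "finite (kube_ids_upto N S)"
  by (simp add: kube_ids_upto_def)

lemma kube_ids_upto_mono: "N \<le> N' \<Longrightarrow> kube_ids_upto N S \<subseteq> kube_ids_upto N' S"
  by (auto simp: kube_ids_upto_def)

lemma sparse_sum_mono: "N \<le> N' \<Longrightarrow> sparse_sum N z \<le> sparse_sum N' z"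
  unfolding sparse_sum_def using kube_ids_upto_mono[of N N']
  by (intro sum_mono sum_mono2) (auto simp: tent_average_def)

text \<open>Sparse domination.  The finite truncations of the kernel bound increase, so monotone
  convergence moves the supremum out of the integral.\<close>

lemma toeplitz_le_sparse_sum:
  assumes c: "0 < c"
    and ker: "\<And>z w :: complex^'n. norm z < 1 \<Longrightarrow> norm w < 1 \<Longrightarrow>
      \<exists>S\<in>\<SS>. \<exists>K\<in>kube_ids S. z \<in> tent \<theta> S K \<and> w \<in> tent \<theta> S K \<and>
        1 / norm (1 - herm z w) ^ (CARD('n) + 1) \<le> c / measure ball_vol (tent \<theta> S K)"
    and z: "norm z < 1"
  shows "ennreal (norm (toeplitz u f z)) \<le> ennreal c * (SUP N. ennreal (sparse_sum N z))"
proof -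
  define k where "k N w = (\<Sum>S\<in>\<SS>. \<Sum>K\<in>kube_ids_upto N S.
      indicator (tent \<theta> S K) z / measure \<mu> (tent \<theta> S K) * indicator (tent \<theta> S K) w)" for N w
  define g where "g N w = ennreal (norm (u w * f w) * k N w)" for N w
  have k0: "0 \<le> k N w" for N w unfolding k_def by (intro sum_nonneg) auto
  have tent_upto: "tent \<theta> S K \<in> sets \<mu>" if "S \<in> \<SS>" "K \<in> kube_ids_upto N S" for S K N
    using that tent_sets by (auto simp: kube_ids_upto_def)
  have "incseq k"
    unfolding incseq_def le_fun_def k_def using kube_ids_upto_mono
    by (intro allI impI sum_mono sum_mono2) auto
  then have inc: "incseq g"
    unfolding incseq_def le_fun_def g_def by (intro allI impI ennreal_leI mult_left_mono) auto
  have [measurable]: "k N \<in> borel_measurable \<mu>" for N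
    unfolding k_def
    by (intro borel_measurable_sum borel_measurable_times borel_measurable_const
        borel_measurable_indicator tent_upto)
  have int_g: "(\<integral>\<^sup>+w. g N w \<partial>\<mu>) = ennreal (sparse_sum N z)" for N
  proof -
    have "(\<integral>\<^sup>+w. g N w \<partial>\<mu>) = (\<integral>\<^sup>+w. ennreal (norm (u w * f w)) * ennreal (k N w) \<partial>\<mu>)"
      by (intro nn_integral_cong) (simp add: g_def ennreal_mult k0)
    also have "\<dots> = (\<integral>\<^sup>+w. ennreal (k N w) \<partial>\<gamma>)"
      unfolding \<gamma>_def by (subst nn_integral_density) auto
    also have "\<dots> = ennreal (sparse_sum N z)"
    proof (rule nn_integral_eq_integral[THEN trans])
      interpret gam: finite_measure \<gamma> by (rule gamma_finite)
      have int: "integrable \<gamma> (\<lambda>w. indicator (tent \<theta> S K) z / measure \<mu> (tent \<theta> S K)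
          * indicator (tent \<theta> S K) w :: real)" if "S \<in> \<SS>" "K \<in> kube_ids_upto N S" for S K
        using tent_upto[OF that]
        by (intro integrable_mult_right integrable_real_indicator)
           (auto simp: gam.emeasure_finite less_top[symmetric])
      show "integrable \<gamma> (k N)"
        unfolding k_def by (intro Bochner_Integration.integrable_sum int)
      have "(\<integral>w. k N w \<partial>\<gamma>) = (\<Sum>S\<in>\<SS>. \<Sum>K\<in>kube_ids_upto N S.
          \<integral>w. indicator (tent \<theta> S K) z / measure \<mu> (tent \<theta> S K) * indicator (tent \<theta> S K) w \<partial>\<gamma>)"
      proof -
        have "(\<integral>w. k N w \<partial>\<gamma>) = (\<Sum>S\<in>\<SS>. \<integral>w. (\<Sum>K\<in>kube_ids_upto N S.
          indicator (tent \<theta> S K) z / measure \<mu> (tent \<theta> S K) * indicator (tent \<theta> S K) w) \<partial>\<gamma>)"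
          unfolding k_def
          by (intro Bochner_Integration.integral_sum Bochner_Integration.integrable_sum int)
        then show ?thesis
          by (simp only: Bochner_Integration.integral_sum[OF int] cong: sum.cong)
      qed
      also have "\<dots> = sparse_sum N z"
        unfolding sparse_sum_def
      proof (intro sum.cong refl)
        fix S K assume "S \<in> \<SS>" "K \<in> kube_ids_upto N S"
        then have "tent \<theta> S K \<in> sets \<gamma>" using tent_upto by simp
        then show "(\<integral>w. indicator (tent \<theta> S K) z / measure \<mu> (tent \<theta> S K) * indicator (tent \<theta> S K) w \<partial>\<gamma>)
            = tent_average S K * indicator (tent \<theta> S K) z"
          by (simp add: tent_average_def Int_absorb2[OF tent_subset])
      qed
      finally show "ennreal (\<integral>w. k N w \<partial>\<gamma>) = ennreal (sparse_sum N z)" by simp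
    qed (simp add: k0)
    finally show ?thesis .
  qed
  have "ennreal (norm (toeplitz u f z)) \<le> (\<integral>\<^sup>+w. ennreal (norm (toeplitz_integrand u f z w)) \<partial>\<mu>)"
    unfolding toeplitz_def by (rule integral_norm_bound_ennreal[OF integrand_integrable[OF z]])
  also have "\<dots> \<le> (\<integral>\<^sup>+w. ennreal c * (SUP N. g N w) \<partial>\<mu>)"
  proof (rule nn_integral_mono)
    fix w assume "w \<in> space \<mu>"
    then have w: "norm w < 1" by (simp add: space_ball_vol)
    obtain S K where SK: "S \<in> \<SS>" "K \<in> kube_ids S" "z \<in> tent \<theta> S K" "w \<in> tent \<theta> S K"
      "1 / norm (1 - herm z w) ^ (CARD('n) + 1) \<le> c / measure \<mu> (tent \<theta> S K)"
      using ker[OF z w] by blast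
    define N where "N = max (fst K) (snd K)"
    have KN: "K \<in> kube_ids_upto N S"
      using SK by (cases K) (auto simp: kube_ids_upto_def N_def)
    let ?t = "\<lambda>S K. indicator (tent \<theta> S K) z / measure \<mu> (tent \<theta> S K) * indicator (tent \<theta> S K) w :: real"
    have "1 / measure \<mu> (tent \<theta> S K) = ?t S K" using SK by simp
    also have "\<dots> \<le> (\<Sum>K\<in>kube_ids_upto N S. ?t S K)"
      using KN by (intro member_le_sum) auto
    also have "\<dots> \<le> k N w"
      unfolding k_def using SK finite_structures
      by (intro member_le_sum[of S \<SS> "\<lambda>S. \<Sum>K\<in>kube_ids_upto N S. ?t S K"] sum_nonneg) auto
    finally have kN: "1 / measure \<mu> (tent \<theta> S K) \<le> k N w" .
    have "norm (toeplitz_integrand u f z w)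
        = norm (u w * f w) * (1 / norm (1 - herm z w) ^ (CARD('n) + 1))"
      by (simp add: toeplitz_integrand_def norm_divide norm_power norm_mult)
    also have "\<dots> \<le> norm (u w * f w) * (c * (1 / measure \<mu> (tent \<theta> S K)))"
      using SK(5) by (intro mult_left_mono) auto
    also have "\<dots> \<le> norm (u w * f w) * (c * k N w)"
      using kN c by (intro mult_left_mono) auto
    finally have "ennreal (norm (toeplitz_integrand u f z w)) \<le> ennreal (c * (norm (u w * f w) * k N w))"
      by (intro ennreal_leI) (simp add: mult_ac)
    also have "\<dots> = ennreal c * g N w"
      using c k0 by (simp add: g_def ennreal_mult)
    also have "\<dots> \<le> ennreal c * (SUP N. g N w)"
      by (intro mult_left_mono SUP_upper) auto
    finally show "ennreal (norm (toeplitz_integrand u f z w)) \<le> ennreal c * (SUP N. g N w)" .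
  qed
  also have "\<dots> = ennreal c * (\<integral>\<^sup>+w. (SUP N. g N w) \<partial>\<mu>)"
    by (rule nn_integral_cmult) (simp add: g_def)
  also have "(\<integral>\<^sup>+w. (SUP N. g N w) \<partial>\<mu>) = (SUP N. \<integral>\<^sup>+w. g N w \<partial>\<mu>)"
  proof (rule nn_integral_monotone_convergence_SUP[OF inc])
    show "g N \<in> borel_measurable \<mu>" for N unfolding g_def by measurable
  qed
  finally show ?thesis by (simp add: int_g)
qed

lemma toeplitz_weak_type:
  assumes c: "0 < c"
    and ker: "\<And>z w :: complex^'n. norm z < 1 \<Longrightarrow> norm w < 1 \<Longrightarrow>
      \<exists>S\<in>\<SS>. \<exists>K\<in>kube_ids S. z \<in> tent \<theta> S K \<and> w \<in> tent \<theta> S K \<and>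
        1 / norm (1 - herm z w) ^ (CARD('n) + 1) \<le> c / measure ball_vol (tent \<theta> S K)"
  shows "weak_L1_norm \<sigma> (toeplitz u f) \<le> ennreal (c * (card \<SS>)\<^sup>2 * sparse_const)
    * uB1_const \<theta> \<SS> u \<sigma> * ennreal log_factor * L1_norm \<sigma> f"
    (is "_ \<le> ?R")
proof (unfold weak_L1_norm_def, rule SUP_least)
  fix t :: real assume "t \<in> {0<..}"
  then have t: "0 < t" by simp
  let ?X = "{z \<in> ball 0 1. t < norm (toeplitz u f z)}"
  define Y where "Y N = {z \<in> ball 0 1. t / c < sparse_sum N z}" for N
  have [measurable]: "sparse_sum N \<in> borel_measurable \<mu>" for N
    unfolding sparse_sum_def using tent_sets
    by (intro borel_measurable_sum borel_measurable_times borel_measurable_const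
        borel_measurable_indicator) (auto simp: kube_ids_upto_def)
  have Y_sets: "Y N \<in> sets \<mu>" for N
  proof -
    have "{z \<in> space \<mu>. t / c < sparse_sum N z} \<in> sets \<mu>" by measurable
    then show ?thesis by (simp add: Y_def space_ball_vol)
  qed
  have X_sets: "?X \<in> sets \<mu>"
  proof -
    note toeplitz_measurable [measurable]
    have "{z \<in> space \<mu>. t < norm (toeplitz u f z)} \<in> sets \<mu>" by measurable
    then show ?thesis by (simp add: space_ball_vol)
  qed
  have XY: "?X \<subseteq> (\<Union>N. Y N)"
  proof
    fix z assume z: "z \<in> ?X"
    show "z \<in> (\<Union>N. Y N)"
    proof (rule ccontr)
      assume "z \<notin> (\<Union>N. Y N)"
      then have le: "sparse_sum N z \<le> t / c" for N using z by (auto simp: Y_def not_less)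
      have "ennreal (norm (toeplitz u f z)) \<le> ennreal c * (SUP N. ennreal (sparse_sum N z))"
        using z by (intro toeplitz_le_sparse_sum c ker) auto
      also have "\<dots> \<le> ennreal c * ennreal (t / c)"
        by (intro mult_left_mono SUP_least ennreal_leI le) auto
      also have "\<dots> = ennreal t" using c t by (simp add: ennreal_mult'[symmetric])
      finally show False using z t by (simp add: ennreal_le_iff2)
    qed
  qed
  show "ennreal t * weight_meas \<sigma> ?X \<le> ?R"
  proof (cases "emeasure \<nu> (ball 0 1) = \<infinity>")
    case True
    \<comment> \<open>then \<open>\<gamma> = 0\<close>, so all averages and with them \<open>toeplitz u f\<close> vanish\<close>
    have g0: "measure \<gamma> F = 0" if "F \<in> sets \<mu>" for F
    proof -
      have "emeasure \<gamma> F \<le> emeasure \<gamma> (ball 0 1)"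
        using that by (intro emeasure_mono) (auto simp: sets_ball_vol_iff)
      then show ?thesis using gamma_null[OF True] by (simp add: measure_def)
    qed
    have "sparse_sum N z = 0" for N z
      unfolding sparse_sum_def tent_average_def
      by (intro sum.neutral ballI) (auto simp: g0 tent_sets kube_ids_upto_def)
    then have "?X = {}" using XY divide_pos_pos[OF t c] by (auto simp: Y_def)
    then show ?thesis by (simp add: weight_meas_def)
  next
    case False
    then have fin: "emeasure \<nu> (ball 0 1) < \<infinity>" by (simp add: less_top)
    interpret nu: finite_measure \<nu> using fin by (intro finite_measureI) auto
    interpret eta: finite_measure \<eta> by (rule eta_finite)
    define U where "U = enn2real (uB1_const \<theta> \<SS> u \<sigma>)"
    define R where "R = (card \<SS>)\<^sup>2 * sparse_const * log_factor * U * measure \<eta> (ball 0 1)"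
    have U: "uB1_const \<theta> \<SS> u \<sigma> = ennreal U" "0 \<le> U"
      using uB1_finite by (auto simp: U_def ennreal_enn2real_if)
    have sc: "0 \<le> sparse_const" using A_ge_1 by (simp add: sparse_const_def)
    have R: "ennreal (c * R) = ?R"
      using c U sc log_factor_ge_1
      by (simp add: R_def ennreal_mult[symmetric] eta_ball[symmetric] eta.emeasure_eq_measure mult_ac)
    have "emeasure \<nu> (Y N) \<le> ennreal (c * R / t)" for N
    proof -
      have "t / c * measure \<nu> (Y N) \<le> R"
        unfolding Y_def sparse_sum_def R_def U_def using t c fin
        by (intro weak_type_structures) (auto simp: kube_ids_upto_def)
      then have "measure \<nu> (Y N) \<le> c * R / t" using t c by (simp add: field_simps)
      then show ?thesis unfolding nu.emeasure_eq_measure by (rule ennreal_leI)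
    qed
    moreover have "(SUP N. emeasure \<nu> (Y N)) = emeasure \<nu> (\<Union>N. Y N)"
    proof (rule SUP_emeasure_incseq)
      show "incseq Y" unfolding incseq_def Y_def
        using sparse_sum_mono by (auto intro: less_le_trans)
    qed (use Y_sets in auto)
    ultimately have "emeasure \<nu> (\<Union>N. Y N) \<le> ennreal (c * R / t)"
      by (metis SUP_least)
    moreover have "emeasure \<nu> ?X \<le> emeasure \<nu> (\<Union>N. Y N)"
      using XY Y_sets by (intro emeasure_mono) auto
    ultimately have "ennreal t * weight_meas \<sigma> ?X \<le> ennreal t * ennreal (c * R / t)"
      unfolding weight_meas_eq[OF X_sets] by (intro mult_left_mono) auto
    also have "\<dots> = ennreal (c * R)" using t by (simp add: ennreal_mult'[symmetric])
    finally show ?thesis unfolding R .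
  qed
qed

end

text \<open>A kube has positive measure and so contains a point where the weight is positive.\<close>

lemma kube_constant_ge_1:
  assumes "dyadic_tents \<SS> \<theta> A" and w: "weight \<sigma>"
    and c: "\<forall>(S, K)\<in>all_kubes \<SS>. \<forall>z\<in>kube \<theta> S K. \<forall>w\<in>kube \<theta> S K. \<sigma> z \<le> c * \<sigma> w"
  shows "1 \<le> (c::real)"
proof -
  interpret dyadic_tents \<SS> \<theta> A by fact
  obtain S K where SK: "S \<in> \<SS>" "K \<in> kube_ids S" using carleson_tent_covered[of 0] by auto
  have "0 < A * measure ball_vol (kube \<theta> S K)"
    using tent_pos[OF SK] tent_le_kube[OF SK] by linarith
  then have pos: "0 < measure ball_vol (kube \<theta> S K)" using A_ge_1 by (simp add: zero_less_mult_iff)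
  have "\<exists>z\<in>kube \<theta> S K. 0 < \<sigma> z"
  proof (rule ccontr)
    assume *: "\<not> ?thesis"
    have "AE z in ball_vol. 0 < \<sigma> z" using w by (simp add: weight_def)
    then have "AE z in ball_vol. z \<notin> kube \<theta> S K" by eventually_elim (use * in auto)
    then have "kube \<theta> S K \<in> null_sets ball_vol"
      using kube_sets[OF SK] by (simp add: AE_iff_null_sets)
    then show False using pos measure_eq_0_null_sets by force
  qed
  then obtain z where z: "z \<in> kube \<theta> S K" "0 < \<sigma> z" by blast
  have "(S, K) \<in> all_kubes \<SS>" using SK by (simp add: all_kubes_def)
  then have "\<sigma> z \<le> c * \<sigma> z" using c z by blast
  then show ?thesis using z by simp
qed

theorem corollary1p10:
  fixes \<SS> :: "('n::finite) dyadic_structure set"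
    and \<theta> \<rho> C\<^sub>0 \<alpha> :: real
  assumes "dyadic_system \<theta> \<rho> C\<^sub>0 \<SS>"
    and "dyadic_doubling \<theta> \<SS> \<alpha>"
  shows "\<exists>C::real. C > 0 \<and>
    (\<forall>(u :: complex^'n \<Rightarrow> complex) (\<sigma> :: complex^'n \<Rightarrow> real) (c :: real).
       u \<in> Linfty \<and> \<sigma> \<in> uB1_class \<theta> \<SS> u \<inter> Binf_class \<theta> \<SS> \<and> c > 0 \<and>
       (\<forall>(S, K) \<in> all_kubes \<SS>. \<forall>z \<in> kube \<theta> S K. \<forall>w \<in> kube \<theta> S K. \<sigma> z \<le> c * \<sigma> w)
       \<longrightarrow>
       (\<forall>f \<in> L1_space \<sigma>.
          (\<forall>z \<in> ball 0 1. integrable ball_vol (toeplitz_integrand u f z)) \<and>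
          toeplitz u f \<in> weak_L1_space \<sigma>) \<and>
       weak_op_norm \<sigma> (toeplitz u)
         \<le> ennreal C * uB1_const \<theta> \<SS> u \<sigma>
           * ennreal (c powr (1 / (2 * \<alpha> * enn2real (Binf_const \<theta> \<SS> \<sigma>) + 1)))
           * ennreal (ln (exp 1 + enn2real (Binf_const \<theta> \<SS> \<sigma>))))"
proof -
  obtain A where A: "dyadic_tents \<SS> \<theta> A" by (rule dyadic_system_tents[OF assms(1)])
  interpret dyadic_tents \<SS> \<theta> A by fact
  obtain k where k: "0 < k"
    "\<And>z w :: complex^'n. norm z < 1 \<Longrightarrow> norm w < 1 \<Longrightarrow>
      \<exists>S\<in>\<SS>. \<exists>K\<in>kube_ids S. z \<in> tent \<theta> S K \<and> w \<in> tent \<theta> S K \<and>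
        1 / norm (1 - herm z w) ^ (CARD('n) + 1) \<le> k / measure ball_vol (tent \<theta> S K)"
    by (rule kernel_le_tent) blast
  define C where "C = k * (card \<SS>)\<^sup>2 * (1 + 128 * A * (ln A + 2) + 65536 * A)"
  have "\<SS> \<noteq> {}" using carleson_tent_covered[of 0] by auto
  then have C: "0 < C"
    unfolding C_def using k(1) A_ge_1 finite_structures
    by (intro mult_pos_pos) (auto simp: card_gt_0_iff intro!: add_pos_nonneg)
  show ?thesis
  proof (intro exI[of _ C] conjI C allI impI)
    fix u :: "complex^'n \<Rightarrow> complex" and \<sigma> :: "complex^'n \<Rightarrow> real" and c :: real
    assume h: "u \<in> Linfty \<and> \<sigma> \<in> uB1_class \<theta> \<SS> u \<inter> Binf_class \<theta> \<SS> \<and> c > 0 \<and>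
       (\<forall>(S, K) \<in> all_kubes \<SS>. \<forall>z \<in> kube \<theta> S K. \<forall>w \<in> kube \<theta> S K. \<sigma> z \<le> c * \<sigma> w)"
    let ?e = "1 / (2 * \<alpha> * enn2real (Binf_const \<theta> \<SS> \<sigma>) + 1)"
    let ?L = "ln (exp 1 + enn2real (Binf_const \<theta> \<SS> \<sigma>))"
    let ?R = "ennreal C * uB1_const \<theta> \<SS> u \<sigma> * ennreal (c powr ?e) * ennreal ?L"
    have \<sigma>: "weight \<sigma>" "uB1_const \<theta> \<SS> u \<sigma> < \<infinity>" "Binf_const \<theta> \<SS> \<sigma> < \<infinity>"
      using h by (auto simp: uB1_class_def Binf_class_def)
    have "1 \<le> c" using h by (intro kube_constant_ge_1[OF A \<sigma>(1)]) auto
    moreover have "0 \<le> ?e" using assms(2) by (auto simp: dyadic_doubling_def)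
    ultimately have c1: "1 \<le> c powr ?e" by (rule ge_one_powr_ge_zero)
    have f: "(\<forall>z \<in> ball 0 1. integrable ball_vol (toeplitz_integrand u f z)) \<and>
        toeplitz u f \<in> borel_measurable ball_vol \<and>
        weak_L1_norm \<sigma> (toeplitz u f) \<le> ?R * L1_norm \<sigma> f" if "f \<in> L1_space \<sigma>" for f
    proof -
      interpret weighted_tents \<SS> \<theta> A u \<sigma> f
        using h \<sigma> that by unfold_locales (auto simp: Linfty_def)
      have "weak_L1_norm \<sigma> (toeplitz u f)
          \<le> ennreal C * uB1_const \<theta> \<SS> u \<sigma> * ennreal ?L * L1_norm \<sigma> f"
        using toeplitz_weak_type[OF k] unfolding C_def sparse_const_def log_factor_def by simp
      also have "\<dots> \<le> ennreal C * uB1_const \<theta> \<SS> u \<sigma> * (ennreal (c powr ?e) * ennreal ?L) * L1_norm \<sigma> f"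
      proof (intro mult_right_mono mult_left_mono)
        have "1 * ennreal ?L \<le> ennreal (c powr ?e) * ennreal ?L"
          using c1 by (intro mult_right_mono) (auto simp flip: ennreal_1 intro: ennreal_leI)
        then show "ennreal ?L \<le> ennreal (c powr ?e) * ennreal ?L" by simp
      qed auto
      finally have "weak_L1_norm \<sigma> (toeplitz u f) \<le> ?R * L1_norm \<sigma> f" by (simp add: mult.assoc)
      then show ?thesis using integrand_integrable toeplitz_measurable by auto
    qed
    have "?R * L1_norm \<sigma> f < \<infinity>" if "f \<in> L1_space \<sigma>" for f
      using \<sigma>(2) that by (auto simp: L1_space_def ennreal_mult_less_top)
    then show "\<forall>f \<in> L1_space \<sigma>.
          (\<forall>z \<in> ball 0 1. integrable ball_vol (toeplitz_integrand u f z)) \<and>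
          toeplitz u f \<in> weak_L1_space \<sigma>"
      using f unfolding weak_L1_space_def by (auto intro: le_less_trans)
    show "weak_op_norm \<sigma> (toeplitz u) \<le> ?R"
      unfolding weak_op_norm_def by (rule Inf_lower) (use f in auto)
  qed
qed

end
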